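(* Let $u^\circ:\mathbb R\to\mathbb R$ be bounded and uniformly continuous, and let $u$ be a subsolution and $v$ a supersolution of (HJ). If $u(0,\cdot)\le u^\circ\le v(0,\cdot)$ on $\mathbb R$, then $u\le v$ on $Q$.
   Context: $Q=(0,\infty)\times\mathbb R$, $B_\rho=(-\rho,\rho)$. (HJ) is formally $u_t=\mathcal I[u]\,|u_x|$ with $\mathcal I[w](x)=\int_{\mathbb R}(w(x+z)-w(x)-zw'(x))\frac{dz}{z^2}$. For $\rho>0$, $u$ bounded and $\phi\in C^2(Q)$, put $$H_\rho[\phi,u](t,x)=|\phi_x(t,x)|\Big(\int_{B_\rho}\big(\phi(t,x+z)-\phi(t,x)-\phi_x(t,x)z\big)\tfrac{dz}{z^2}+\int_{\mathbb R\setminus B_\rho}\big(u(t,x+z)-u(t,x)\big)\tfrac{dz}{z^2}\Big).$$ A bounded upper semicontinuous $u:Q\to\mathbb R$ is a subsolution of (HJ) if, whenever $\phi\in C^2(Q)$ and $u-\phi$ has a global maximum at $(\bar t,\bar x)\in Q$: if $\phi_x(\bar t,\bar x)\ne0$ then $\phi_t(\bar t,\bar x)\le H_\rho[\phi,u](\bar t,\bar x)$; if $\phi(t,x)=c|x-\bar x|^4+g(t)$ for some $c\in\mathbb R$ and some $g$, then $\phi_t(\bar t,\bar x)\le0$; otherwise no condition. A bounded lower semicontinuous $v:Q\to\mathbb R$ is a supersolution if, whenever $\psi\in C^2(Q)$ and $v-\psi$ has a global minimum at $(\bar t,\bar x)\in Q$: if $\psi_x(\bar t,\bar x)\neq0$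 then $\psi_t(\bar t,\bar x)\ge H_\rho[\psi,v](\bar t,\bar x)$; if $\psi(t,x)=c|x-\bar x|^4+g(t)$ then $\psi_t(\bar t,\bar x)\ge0$; otherwise no condition. These notions do not depend on the choice of $\rho>0$. Sub-/supersolutions are extended to $t=0$ by $u(0,x):=\limsup_{Q\ni(s,y)\to(0,x)}u(s,y)$ and $v(0,x):=\liminf_{Q\ni(s,y)\to(0,x)}v(s,y)$. *)

theory Defs
  imports "HOL-Analysis.Analysis"
begin

text \<open>Space-time points are pairs \<open>(t, x)\<close>. Functions on \<open>Q\<close> are total functions whose values
  outside \<open>Q\<close> are never used.\<close>

definition Q :: "(real \<times> real) set" where
  "Q = {0<..} \<times> UNIV"

definition dt :: "(real \<times> real \<Rightarrow> real) \<Rightarrow> real \<times> real \<Rightarrow> real" where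
  "dt f = (\<lambda>(t, x). deriv (\<lambda>s. f (s, x)) t)"

definition dx :: "(real \<times> real \<Rightarrow> real) \<Rightarrow> real \<times> real \<Rightarrow> real" where
  "dx f = (\<lambda>(t, x). deriv (\<lambda>y. f (t, y)) x)"

text \<open>Differentiability of the sections is required explicitly because \<^const>\<open>deriv\<close> is total.
  The domain is meant to be open.\<close>

definition C1_on :: "(real \<times> real) set \<Rightarrow> (real \<times> real \<Rightarrow> real) \<Rightarrow> bool" where
  "C1_on S f \<longleftrightarrow>
     (\<forall>(t, x)\<in>S. (\<lambda>s. f (s, x)) differentiable (at t) \<and> (\<lambda>y. f (t, y)) differentiable (at x)) \<and>
     continuous_on S (dt f) \<and> continuous_on S (dx f)"

definition C2_on :: "(real \<times> real) set \<Rightarrow> (real \<times> real \<Rightarrow> real) \<Rightarrow> bool" where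
  "C2_on S f \<longleftrightarrow> C1_on S f \<and> C1_on S (dt f) \<and> C1_on S (dx f)"

definition usc_on :: "'a::topological_space set \<Rightarrow> ('a \<Rightarrow> real) \<Rightarrow> bool" where
  "usc_on S f \<longleftrightarrow> (\<forall>p\<in>S. \<forall>a>f p. \<forall>\<^sub>F q in at p within S. f q < a)"

definition lsc_on :: "'a::topological_space set \<Rightarrow> ('a \<Rightarrow> real) \<Rightarrow> bool" where
  "lsc_on S f \<longleftrightarrow> (\<forall>p\<in>S. \<forall>a<f p. \<forall>\<^sub>F q in at p within S. a < f q)"

text \<open>For \<open>\<phi>\<close> of class \<open>C\<^sup>2\<close> on \<open>Q\<close>, \<open>u\<close> bounded and semicontinuous on \<open>Q\<close>, and \<open>t > 0\<close>, both
  integrals converge absolutely, so the Lebesgue integrals below have their usual meaning. The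
  point \<open>z = 0\<close>, where the first integrand is \<open>0 / 0 = 0\<close>, is a null set.\<close>

definition H :: "real \<Rightarrow> (real \<times> real \<Rightarrow> real) \<Rightarrow> (real \<times> real \<Rightarrow> real) \<Rightarrow> real \<times> real \<Rightarrow> real" where
  "H \<rho> \<phi> u = (\<lambda>(t, x). \<bar>dx \<phi> (t, x)\<bar> *
     ((LINT z:{-\<rho><..<\<rho>}|lborel. (\<phi> (t, x + z) - \<phi> (t, x) - dx \<phi> (t, x) * z) / z\<^sup>2) +
      (LINT z:(- {-\<rho><..<\<rho>})|lborel. (u (t, x + z) - u (t, x)) / z\<^sup>2)))"

definition quartic_at :: "real \<Rightarrow> (real \<times> real \<Rightarrow> real) \<Rightarrow> bool" where
  "quartic_at xb \<phi> \<longleftrightarrow>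
     (\<exists>(c::real) (g::real \<Rightarrow> real). \<forall>(t, x)\<in>Q. \<phi> (t, x) = c * \<bar>x - xb\<bar> ^ 4 + g t)"

definition subsolution :: "real \<Rightarrow> (real \<times> real \<Rightarrow> real) \<Rightarrow> bool" where
  "subsolution \<rho> u \<longleftrightarrow> bounded (u ` Q) \<and> usc_on Q u \<and>
     (\<forall>\<phi> tb xb. C2_on Q \<phi> \<longrightarrow> (tb, xb) \<in> Q \<longrightarrow>
        (\<forall>q\<in>Q. u q - \<phi> q \<le> u (tb, xb) - \<phi> (tb, xb)) \<longrightarrow>
          (dx \<phi> (tb, xb) \<noteq> 0 \<longrightarrow> dt \<phi> (tb, xb) \<le> H \<rho> \<phi> u (tb, xb)) \<and>
          (quartic_at xb \<phi> \<longrightarrow> dt \<phi> (tb, xb) \<le> 0))"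

definition supersolution :: "real \<Rightarrow> (real \<times> real \<Rightarrow> real) \<Rightarrow> bool" where
  "supersolution \<rho> v \<longleftrightarrow> bounded (v ` Q) \<and> lsc_on Q v \<and>
     (\<forall>\<psi> tb xb. C2_on Q \<psi> \<longrightarrow> (tb, xb) \<in> Q \<longrightarrow>
        (\<forall>q\<in>Q. v (tb, xb) - \<psi> (tb, xb) \<le> v q - \<psi> q) \<longrightarrow>
          (dx \<psi> (tb, xb) \<noteq> 0 \<longrightarrow> H \<rho> \<psi> v (tb, xb) \<le> dt \<psi> (tb, xb)) \<and>
          (quartic_at xb \<psi> \<longrightarrow> 0 \<le> dt \<psi> (tb, xb)))"

text \<open>The values at \<open>t = 0\<close> of a subsolution and of a supersolution. They are finite for functions
  bounded on \<open>Q\<close>; the extended reals serve only to have \<^const>\<open>Limsup\<close> and \<^const>\<open>Liminf\<close>.\<close>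

definition initial_upper :: "(real \<times> real \<Rightarrow> real) \<Rightarrow> real \<Rightarrow> ereal" where
  "initial_upper u x = Limsup (at (0, x) within Q) (\<lambda>p. ereal (u p))"

definition initial_lower :: "(real \<times> real \<Rightarrow> real) \<Rightarrow> real \<Rightarrow> ereal" where
  "initial_lower v x = Liminf (at (0, x) within Q) (\<lambda>p. ereal (v p))"

end

theory Submission
  imports Defs
begin

text \<open>
  With \<open>w = - v\<close>, both \<open>u\<close> and \<open>w\<close> are subsolutions. Quartic barriers centred at each point and the
  uniform continuity of \<open>u0\<close> control \<open>u\<close> and \<open>w\<close> near \<open>t = 0\<close> uniformly in space. If \<open>u + w\<close> is positive
  somewhere, consider the supremum of
  \<open>u (t, x) + w (s, y) - N (x - y)\<^sup>4 - N (t - s)\<^sup>2 - l (t + s)\<close>, which is approached only at times bounded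
  away from 0 but need not be attained, since \<open>x\<close> ranges over an unbounded set.
  If some near-maximizers have \<open>x - y\<close> close to 0, freeze one pair of variables at a time: the frozen
  functional attains its maximum, its test function is exactly quartic in space, and its gradient there is small,
  so both time derivatives are almost nonpositive, while they add up to \<open>2 l\<close>.
  Otherwise \<open>x - y\<close> stays away from 0, so that after a small localizing perturbation the gradient at the
  maximum is nonzero and the equation can be used for both functions. The singular parts are \<open>O(r)\<close> once
  the radius \<open>\<rho>\<close> is replaced by a small \<open>r\<close>, and the nonlocal parts nearly cancel.
\<close>

subsection \<open>Semicontinuous functions\<close>

text \<open>Where the spatial gradient vanishes, only test functions that are exactly quartic about
  the contact point say anything. This dictates the penalty \<open>(x - y)^4\<close> and rules out
  adding a localizing term there; where the gradient is nonzero such a term is harmless. Unattained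
  suprema and degenerate gradients thus ask for incompatible remedies, hence the split on the size
  of \<open>x - y\<close>. The operator has order one, so a test function with bounded second-order
  remainder contributes little on a short interval while \<open>N\<close> stays fixed.
  \<open>N\<close> is chosen once, large enough for the uniform continuity of \<open>u0\<close> to
  keep near-maximizers away from time 0, and is never sent to infinity. The notion of subsolution
  fixes the radius \<rho>, so the inequality at smaller radii has to be derived from it. The
  constants are chosen in the order \<open>l\<close>, \<tau>, \<open>N\<close>, \<eta>,
  \<open>r\<close>, \<delta>. The tail mass \<open>J\<close> of the kernel blows up as
  \<open>r\<close> tends to 0, so \<delta>, which multiplies it, comes last. The localizer changes
  only one of the two gradients. The factors \<open>|u_x|\<close> and \<open>|w_x|\<close> then
  differ slightly, and their mismatch times a nonlocal term is a further error to control.\<close>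

lemma usc_onD:
  assumes "usc_on S f" "p \<in> S" "f p < a"
  shows "\<exists>U. open U \<and> p \<in> U \<and> (\<forall>q\<in>U \<inter> S. f q < a)"
proof -
  have "\<forall>\<^sub>F q in at p within S. f q < a"
    using assms by (auto simp: usc_on_def)
  then obtain U where U: "open U" "p \<in> U" "\<forall>q\<in>U. q \<noteq> p \<longrightarrow> q \<in> S \<longrightarrow> f q < a"
    by (auto simp: eventually_at_topological)
  have "f q < a" if "q \<in> U \<inter> S" for q
    using that U(3) assms(3) by (cases "q = p") auto
  with U show ?thesis by blast
qed

lemma usc_onI:
  assumes "\<And>p a. p \<in> S \<Longrightarrow> f p < a \<Longrightarrow> \<exists>U. open U \<and> p \<in> U \<and> (\<forall>q\<in>U \<inter> S. f q < a)"
  shows "usc_on S f"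
  unfolding usc_on_def
proof (intro ballI allI impI)
  fix p a assume "p \<in> S" "f p < a"
  from assms[OF this] show "\<forall>\<^sub>F q in at p within S. f q < a"
    by (auto simp: eventually_at_topological)
qed

lemma usc_on_subset: "usc_on S f \<Longrightarrow> T \<subseteq> S \<Longrightarrow> usc_on T f"
  unfolding usc_on_def by (meson at_le filter_leD subsetD)

lemma usc_on_add:
  assumes "usc_on S f" "usc_on S g"
  shows "usc_on S (\<lambda>p. f p + g p)"
proof (rule usc_onI)
  fix p a assume p: "p \<in> S" and "f p + g p < a"
  define e where "e = (a - f p - g p) / 2"
  have e: "e > 0" using \<open>f p + g p < a\<close> by (simp add: e_def)
  obtain U where U: "open U" "p \<in> U" "\<forall>q\<in>U \<inter> S. f q < f p + e"
    using usc_onD[OF assms(1) p, of "f p + e"] e by auto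
  obtain V where V: "open V" "p \<in> V" "\<forall>q\<in>V \<inter> S. g q < g p + e"
    using usc_onD[OF assms(2) p, of "g p + e"] e by auto
  have "f q + g q < a" if "q \<in> (U \<inter> V) \<inter> S" for q
  proof -
    have "f q < f p + e" "g q < g p + e" using U(3) V(3) that by auto
    then show ?thesis by (simp add: e_def field_simps)
  qed
  then show "\<exists>U. open U \<and> p \<in> U \<and> (\<forall>q\<in>U \<inter> S. f q + g q < a)"
    using U(1,2) V(1,2) by (intro exI[of _ "U \<inter> V"]) auto
qed

lemma continuous_on_imp_usc_on:
  fixes f :: "'a::topological_space \<Rightarrow> real"
  assumes "continuous_on S f"
  shows "usc_on S f"
  unfolding usc_on_def
proof (intro ballI allI impI)
  fix p a assume "p \<in> S" "f p < a"
  then show "\<forall>\<^sub>F q in at p within S. f q < a"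
    using assms order_tendstoD(2)[of f "f p" "at p within S" a] by (auto simp: continuous_on_def)
qed

lemma usc_on_compose:
  assumes "usc_on T f" "continuous_on S g" "g ` S \<subseteq> T"
  shows "usc_on S (\<lambda>p. f (g p))"
proof (rule usc_onI)
  fix p a assume p: "p \<in> S" and "f (g p) < a"
  then obtain U where U: "open U" "g p \<in> U" "\<forall>q\<in>U \<inter> T. f q < a"
    using usc_onD[OF assms(1), of "g p" a] subsetD[OF assms(3) imageI[OF p]] by blast
  obtain V where V: "open V" "V \<inter> S = g -` U \<inter> S"
    using assms(2) U(1) by (auto simp: continuous_on_open_invariant)
  have "f (g q) < a" if "q \<in> V \<inter> S" for q
  proof -
    have "g q \<in> U" "g q \<in> T" using that V(2) assms(3) by auto
    then show ?thesis using U(3) by simp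
  qed
  then show "\<exists>U. open U \<and> p \<in> U \<and> (\<forall>q\<in>U \<inter> S. f (g q) < a)"
    using p U(2) V by (intro exI[of _ V]) blast
qed

text \<open>Without a maximizer every \<open>p\<close> has a better point \<open>h p\<close>, and
  \<open>f < f (h p)\<close> on a neighbourhood of \<open>p\<close>. Finitely many of these
  neighbourhoods cover \<open>K\<close>; the best \<open>h c\<close> lies in one of them and is
  beaten there.\<close>

lemma usc_on_attains_sup:
  assumes K: "compact K" "K \<noteq> {}" and f: "usc_on K f"
  shows "\<exists>p\<in>K. \<forall>q\<in>K. f q \<le> f p"
proof (rule ccontr)
  assume "\<not> ?thesis"
  then have "\<forall>p\<in>K. \<exists>q\<in>K. f p < f q" by (auto simp: not_le)
  then obtain h where h: "\<And>p. p \<in> K \<Longrightarrow> h p \<in> K \<and> f p < f (h p)" by metis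
  have "\<exists>U. open U \<and> p \<in> U \<and> (\<forall>q\<in>U \<inter> K. f q < f (h p))" if "p \<in> K" for p
    using usc_onD[OF f that] h[OF that] by blast
  then obtain U where U: "\<And>p. p \<in> K \<Longrightarrow> open (U p) \<and> p \<in> U p \<and> (\<forall>q\<in>U p \<inter> K. f q < f (h p))"
    by metis
  obtain C where C: "C \<subseteq> K" "finite C" "K \<subseteq> (\<Union>p\<in>C. U p)"
    using compactE_image[OF K(1), of K U] U by (metis (no_types, lifting) UN_iff subsetI)
  have "C \<noteq> {}" using C K(2) by auto
  obtain c where c: "c \<in> C" "\<forall>p\<in>C. f (h p) \<le> f (h c)"
  proof -
    define M where "M = Max ((\<lambda>p. f (h p)) ` C)"
    have "M \<in> (\<lambda>p. f (h p)) ` C"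
      unfolding M_def using C(2) \<open>C \<noteq> {}\<close> by (intro Max_in) auto
    moreover have "f (h p) \<le> M" if "p \<in> C" for p
      unfolding M_def using C(2) that by (intro Max_ge) auto
    ultimately show thesis using that by auto
  qed
  have hc: "h c \<in> K" using h c C by blast
  then obtain d where "d \<in> C" "h c \<in> U d" using C(3) by blast
  then have "f (h c) < f (h d)" using U[of d] C(1) hc by blast
  with c(2) \<open>d \<in> C\<close> show False by force
qed

text \<open>A substitute for compactness of the domain: one competitor \<open>p0\<close> whose
  superlevel set lies in \<open>K\<close> is enough. The maxima of all penalized functionals on
  unbounded domains are obtained in this way.\<close>

lemma usc_on_attains_sup_superlevel:
  assumes "compact K" "usc_on S f" "K \<subseteq> S" "p0 \<in> S"
    and "\<And>p. p \<in> S \<Longrightarrow> f p0 \<le> f p \<Longrightarrow> p \<in> K"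
  shows "\<exists>p\<in>K. f p0 \<le> f p \<and> (\<forall>q\<in>S. f q \<le> f p)"
proof -
  have p0: "p0 \<in> K" using assms(4,5) by auto
  then obtain p where p: "p \<in> K" "\<forall>q\<in>K. f q \<le> f p"
    using usc_on_attains_sup[OF assms(1) _ usc_on_subset[OF assms(2,3)]] by auto
  moreover have "f q \<le> f p" if "q \<in> S" for q
    using that p p0 assms(5)[of q] by (metis linear order_trans)
  ultimately show ?thesis using p0 by blast
qed

lemma lsc_on_imp_usc_on_uminus: "lsc_on S f \<Longrightarrow> usc_on S (\<lambda>p. - f p)"
  unfolding lsc_on_def usc_on_def
proof (intro ballI allI impI)
  fix p a assume *: "\<forall>p\<in>S. \<forall>a<f p. \<forall>\<^sub>F q in at p within S. a < f q" "p \<in> S" "- f p < a"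
  then have "\<forall>\<^sub>F q in at p within S. - a < f q" by auto
  then show "\<forall>\<^sub>F q in at p within S. - f q < a" by eventually_elim simp
qed

text \<open>Strict sublevel sets are open. Measurability is what allows the nonlocal integrals of a
  merely semicontinuous function to be split and added.\<close>

lemma usc_on_borel_measurable:
  fixes f :: "real \<Rightarrow> real"
  assumes "usc_on UNIV f"
  shows "f \<in> borel_measurable borel"
proof (rule borel_measurableI_less)
  fix y
  have "open {x. f x < y}"
  proof (subst open_subopen, intro ballI)
    fix x assume "x \<in> {x. f x < y}"
    then obtain U where "open U" "x \<in> U" "\<forall>q\<in>U. f q < y"
      using usc_onD[OF assms, of x y] by auto
    then show "\<exists>T. open T \<and> x \<in> T \<and> T \<subseteq> {x. f x < y}" by blast
  qed
  then show "{x \<in> space borel. f x < y} \<in> sets borel" by simp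
qed

subsection \<open>Smooth test functions\<close>

lemma open_Q: "open Q"
  by (simp add: Q_def open_Times)

text \<open>Formulas for \<open>dt\<close> and \<open>dx\<close> are often known only on
  \<open>S\<close>. Since \<open>S\<close> is open and derivatives are local, such formulas can be
  differentiated once more.\<close>

lemma C1_on_cong:
  assumes S: "open S" and eq: "\<And>p. p \<in> S \<Longrightarrow> f p = g p"
  shows "C1_on S f \<longleftrightarrow> C1_on S g" and "\<And>p. p \<in> S \<Longrightarrow> dt f p = dt g p"
    and "\<And>p. p \<in> S \<Longrightarrow> dx f p = dx g p"
proof -
  have t: "\<forall>\<^sub>F s in nhds t. f (s, x) = g (s, x)" if "(t, x) \<in> S" for t x
  proof -
    have "open ((\<lambda>s. (s, x)) -` S)"
      by (intro open_vimage S continuous_intros)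
    then show ?thesis
      using that eq unfolding eventually_nhds by (intro exI[of _ "(\<lambda>s. (s, x)) -` S"]) auto
  qed
  have x: "\<forall>\<^sub>F y in nhds x. f (t, y) = g (t, y)" if "(t, x) \<in> S" for t x
  proof -
    have "open ((\<lambda>y. (t, y)) -` S)"
      by (intro open_vimage S continuous_intros)
    then show ?thesis
      using that eq unfolding eventually_nhds by (intro exI[of _ "(\<lambda>y. (t, y)) -` S"]) auto
  qed
  show dt: "dt f p = dt g p" if "p \<in> S" for p
    using that t[of "fst p" "snd p"] by (auto simp: dt_def split_beta intro!: deriv_cong_ev)
  show dx: "dx f p = dx g p" if "p \<in> S" for p
    using that x[of "fst p" "snd p"] by (auto simp: dx_def split_beta intro!: deriv_cong_ev)
  have "(\<lambda>s. f (s, x)) differentiable (at t) \<longleftrightarrow> (\<lambda>s. g (s, x)) differentiable (at t)"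
    if "(t, x) \<in> S" for t x
    using DERIV_cong_ev[OF refl t[OF that] refl] unfolding real_differentiable_def by metis
  moreover have "(\<lambda>y. f (t, y)) differentiable (at x) \<longleftrightarrow> (\<lambda>y. g (t, y)) differentiable (at x)"
    if "(t, x) \<in> S" for t x
    using DERIV_cong_ev[OF refl x[OF that] refl] unfolding real_differentiable_def by metis
  moreover have "continuous_on S (dt f) \<longleftrightarrow> continuous_on S (dt g)"
    "continuous_on S (dx f) \<longleftrightarrow> continuous_on S (dx g)"
    using dt dx by (auto intro: continuous_on_cong)
  ultimately show "C1_on S f \<longleftrightarrow> C1_on S g" unfolding C1_on_def by fast
qed

lemma C1_on_uminus:
  assumes "C1_on S f"
  shows "\<And>p. p \<in> S \<Longrightarrow> dt (\<lambda>q. - f q) p = - dt f p" "\<And>p. p \<in> S \<Longrightarrow> dx (\<lambda>q. - f q) p = - dx f p"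
    and "C1_on S (\<lambda>q. - f q)"
proof -
  have t: "(\<lambda>s. f (s, x)) differentiable (at t)" and x: "(\<lambda>y. f (t, y)) differentiable (at x)"
    if "(t, x) \<in> S" for t x
    using assms that unfolding C1_on_def by auto
  show *: "dt (\<lambda>q. - f q) p = - dt f p" if "p \<in> S" for p
    using t[of "fst p" "snd p"] that
    by (auto simp: dt_def split_beta field_differentiable_def real_differentiable_def intro!: deriv_minus)
  show **: "dx (\<lambda>q. - f q) p = - dx f p" if "p \<in> S" for p
    using x[of "fst p" "snd p"] that
    by (auto simp: dx_def split_beta field_differentiable_def real_differentiable_def intro!: deriv_minus)
  have "continuous_on S (dt (\<lambda>q. - f q))" "continuous_on S (dx (\<lambda>q. - f q))"
    using assms unfolding C1_on_def
    by (auto simp: * ** cong: continuous_on_cong intro: continuous_on_minus)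
  then show "C1_on S (\<lambda>q. - f q)"
    using t x by (auto simp: C1_on_def differentiable_minus)
qed

lemma C2_on_uminus:
  assumes S: "open S" and f: "C2_on S f"
  shows "C2_on S (\<lambda>q. - f q)"
proof -
  have *: "C1_on S f" "C1_on S (dt f)" "C1_on S (dx f)" using f by (auto simp: C2_on_def)
  note ** = C1_on_uminus[OF *(1)]
  have "C1_on S (dt (\<lambda>q. - f q))"
    using C1_on_cong(1)[OF S, of "dt (\<lambda>q. - f q)" "\<lambda>q. - dt f q"] **(1) C1_on_uminus(3)[OF *(2)] by blast
  moreover have "C1_on S (dx (\<lambda>q. - f q))"
    using C1_on_cong(1)[OF S, of "dx (\<lambda>q. - f q)" "\<lambda>q. - dx f q"] **(2) C1_on_uminus(3)[OF *(3)] by blast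
  ultimately show ?thesis using **(3) by (simp add: C2_on_def)
qed

text \<open>The operator is odd: \<open>|dx \<phi>|\<close> is unchanged under a change of sign, and
  both integrals are linear in the pair of test function and solution. A quartic remains quartic,
  with \<open>- c\<close> for \<open>c\<close>.\<close>

lemma subsolution_uminus:
  assumes v: "supersolution \<rho> v"
  shows "subsolution \<rho> (\<lambda>p. - v p)"
  unfolding subsolution_def
proof (intro conjI allI impI)
  have "bounded (v ` Q)" using v by (simp add: supersolution_def)
  then show "bounded ((\<lambda>p. - v p) ` Q)" by (simp add: bounded_iff)
  show "usc_on Q (\<lambda>p. - v p)"
    using v by (intro lsc_on_imp_usc_on_uminus) (simp add: supersolution_def)
next
  fix \<phi> t x
  assume \<phi>: "C2_on Q \<phi>" and p: "(t, x) \<in> Q"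
    and max: "\<forall>q\<in>Q. - v q - \<phi> q \<le> - v (t, x) - \<phi> (t, x)"
  define \<psi> where "\<psi> = (\<lambda>q. - \<phi> q)"
  have C1: "C1_on Q \<phi>" using \<phi> by (simp add: C2_on_def)
  have \<psi>: "C2_on Q \<psi>" using C2_on_uminus[OF open_Q \<phi>] by (simp add: \<psi>_def)
  have d: "dt \<psi> (t, x) = - dt \<phi> (t, x)" "dx \<psi> (t, x) = - dx \<phi> (t, x)"
    using C1_on_uminus(1,2)[OF C1 p] by (simp_all add: \<psi>_def)
  have *: "(dx \<psi> (t, x) \<noteq> 0 \<longrightarrow> H \<rho> \<psi> v (t, x) \<le> dt \<psi> (t, x))"
    "(quartic_at x \<psi> \<longrightarrow> 0 \<le> dt \<psi> (t, x))"
    using v \<psi> p max unfolding supersolution_def \<psi>_def by force+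
  have i1: "(LINT z:A|lborel. (\<psi> (t, x + z) - \<psi> (t, x) - dx \<psi> (t, x) * z) / z\<^sup>2) =
    - (LINT z:A|lborel. (\<phi> (t, x + z) - \<phi> (t, x) - dx \<phi> (t, x) * z) / z\<^sup>2)" for A
    unfolding set_lebesgue_integral_def d
    by (subst integral_minus[symmetric]) (simp add: \<psi>_def diff_divide_distrib algebra_simps)
  have i2: "(LINT z:A|lborel. (v (t, x + z) - v (t, x)) / z\<^sup>2) =
    - (LINT z:A|lborel. (- v (t, x + z) - - v (t, x)) / z\<^sup>2)" for A
    unfolding set_lebesgue_integral_def
    by (subst integral_minus[symmetric]) (simp add: diff_divide_distrib algebra_simps)
  have H: "H \<rho> \<psi> v (t, x) = - H \<rho> \<phi> (\<lambda>p. - v p) (t, x)"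
    unfolding H_def prod.case i1 i2 unfolding d by (simp add: algebra_simps)
  show "dt \<phi> (t, x) \<le> H \<rho> \<phi> (\<lambda>p. - v p) (t, x)" if "dx \<phi> (t, x) \<noteq> 0"
    using *(1) that d H by simp
  show "dt \<phi> (t, x) \<le> 0" if q: "quartic_at x \<phi>"
  proof -
    obtain c :: real and g :: "real \<Rightarrow> real" where "\<forall>(t, y)\<in>Q. \<phi> (t, y) = c * \<bar>y - x\<bar> ^ 4 + g t"
      using q unfolding quartic_at_def by (elim exE)
    then have "\<forall>(t, y)\<in>Q. \<psi> (t, y) = - c * \<bar>y - x\<bar> ^ 4 + - g t"
      by (auto simp: \<psi>_def)
    then have "quartic_at x \<psi>" unfolding quartic_at_def by (intro exI)
    then show ?thesis using *(2) d by simp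
  qed
qed

section \<open>Twice continuously differentiable functions of one variable\<close>

text \<open>The derivatives are existential witnesses rather than \<open>deriv\<close> terms, so a
  closure rule only has to exhibit formulas. Continuity of \<open>f\<close> and \<open>f'\<close>
  follows from differentiability.\<close>

definition C2_real :: "(real \<Rightarrow> real) \<Rightarrow> bool" where
  "C2_real f \<longleftrightarrow> (\<exists>f' f''. (\<forall>x. (f has_real_derivative f' x) (at x)) \<and>
     (\<forall>x. (f' has_real_derivative f'' x) (at x)) \<and> continuous_on UNIV f'')"

lemma C2_realI:
  assumes "\<And>x. (f has_real_derivative f' x) (at x)" "\<And>x. (f' has_real_derivative f'' x) (at x)"
    "continuous_on UNIV f''"
  shows "C2_real f"
  using assms unfolding C2_real_def by blast

lemma C2_realE:
  assumes "C2_real f"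
  obtains f' f'' where "\<And>x. (f has_real_derivative f' x) (at x)"
    "\<And>x. (f' has_real_derivative f'' x) (at x)"
    "continuous_on UNIV f" "continuous_on UNIV f'" "continuous_on UNIV f''"
proof -
  obtain f' f'' where *: "\<And>x. (f has_real_derivative f' x) (at x)"
    "\<And>x. (f' has_real_derivative f'' x) (at x)" "continuous_on UNIV f''"
    using assms unfolding C2_real_def by blast
  have "continuous_on UNIV f" "continuous_on UNIV f'"
    using *(1,2) by (auto intro!: DERIV_continuous_on)
  with * show thesis using that by blast
qed

lemma C2_real_const: "C2_real (\<lambda>x. c)"
  by (rule C2_realI[of _ "\<lambda>x. 0" "\<lambda>x. 0"]) auto

lemma C2_real_polynomial:
  assumes "real_polynomial_function f"
  shows "C2_real f"
proof -
  obtain f' where f': "real_polynomial_function f'" "\<And>x. (f has_real_derivative f' x) (at x)"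
    using has_real_derivative_polynomial_function assms by blast
  obtain f'' where f'': "real_polynomial_function f''" "\<And>x. (f' has_real_derivative f'' x) (at x)"
    using has_real_derivative_polynomial_function f'(1) by blast
  show ?thesis
    by (rule C2_realI[OF f'(2) f''(2)])
      (simp add: continuous_on_polymonial_function f''(1) flip: real_polynomial_function_eq)
qed

lemma C2_real_ident: "C2_real (\<lambda>x. x)"
  by (rule C2_realI[of _ "\<lambda>x. 1" "\<lambda>x. 0"]) auto

lemma C2_real_add:
  assumes "C2_real f" "C2_real g"
  shows "C2_real (\<lambda>x. f x + g x)"
proof -
  obtain f' f'' where f: "\<And>x. (f has_real_derivative f' x) (at x)"
    "\<And>x. (f' has_real_derivative f'' x) (at x)" "continuous_on UNIV f''"
    using C2_realE[OF assms(1)] by metis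
  obtain g' g'' where g: "\<And>x. (g has_real_derivative g' x) (at x)"
    "\<And>x. (g' has_real_derivative g'' x) (at x)" "continuous_on UNIV g''"
    using C2_realE[OF assms(2)] by metis
  show ?thesis
    by (rule C2_realI[of _ "\<lambda>x. f' x + g' x" "\<lambda>x. f'' x + g'' x"])
      (auto intro!: derivative_intros f g continuous_intros)
qed

lemma C2_real_mult:
  assumes "C2_real f" "C2_real g"
  shows "C2_real (\<lambda>x. f x * g x)"
proof -
  obtain f' f'' where f: "\<And>x. (f has_real_derivative f' x) (at x)"
    "\<And>x. (f' has_real_derivative f'' x) (at x)"
    "continuous_on UNIV f" "continuous_on UNIV f'" "continuous_on UNIV f''"
    using C2_realE[OF assms(1)] by metis
  obtain g' g'' where g: "\<And>x. (g has_real_derivative g' x) (at x)"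
    "\<And>x. (g' has_real_derivative g'' x) (at x)"
    "continuous_on UNIV g" "continuous_on UNIV g'" "continuous_on UNIV g''"
    using C2_realE[OF assms(2)] by metis
  show ?thesis
    by (rule C2_realI[of _ "\<lambda>x. f' x * g x + f x * g' x"
          "\<lambda>x. f'' x * g x + f' x * g' x + (f' x * g' x + f x * g'' x)"])
      (auto intro!: derivative_eq_intros f g continuous_intros)
qed

lemma C2_real_uminus: "C2_real f \<Longrightarrow> C2_real (\<lambda>x. - f x)"
  using C2_real_mult[OF C2_real_const[of "-1"]] by simp

lemma C2_real_diff: "C2_real f \<Longrightarrow> C2_real g \<Longrightarrow> C2_real (\<lambda>x. f x - g x)"
  using C2_real_add[OF _ C2_real_uminus] by simp

lemma C2_real_power: "C2_real f \<Longrightarrow> C2_real (\<lambda>x. f x ^ n)"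
  by (induction n) (auto intro: C2_real_const C2_real_mult)

lemma C2_real_compose:
  assumes "C2_real f" "C2_real g"
  shows "C2_real (\<lambda>x. f (g x))"
proof -
  obtain f' f'' where f: "\<And>x. (f has_real_derivative f' x) (at x)"
    "\<And>x. (f' has_real_derivative f'' x) (at x)"
    "continuous_on UNIV f" "continuous_on UNIV f'" "continuous_on UNIV f''"
    using C2_realE[OF assms(1)] by metis
  obtain g' g'' where g: "\<And>x. (g has_real_derivative g' x) (at x)"
    "\<And>x. (g' has_real_derivative g'' x) (at x)"
    "continuous_on UNIV g" "continuous_on UNIV g'" "continuous_on UNIV g''"
    using C2_realE[OF assms(2)] by metis
  show ?thesis
    by (rule C2_realI[of _ "\<lambda>x. f' (g x) * g' x" "\<lambda>x. f'' (g x) * g' x * g' x + f' (g x) * g'' x"])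
      (auto intro!: derivative_eq_intros continuous_intros DERIV_chain2[OF f(1) g(1)]
        DERIV_chain2[OF f(2) g(1)] g f(4,5) continuous_on_compose2[OF f(4)] continuous_on_compose2[OF f(5)])
qed

lemma C2_real_inverse:
  assumes "C2_real f" "\<And>x. f x \<noteq> 0"
  shows "C2_real (\<lambda>x. inverse (f x))"
proof -
  obtain f' f'' where f: "\<And>x. (f has_real_derivative f' x) (at x)"
    "\<And>x. (f' has_real_derivative f'' x) (at x)"
    "continuous_on UNIV f" "continuous_on UNIV f'" "continuous_on UNIV f''"
    using C2_realE[OF assms(1)] by metis
  show ?thesis
    by (rule C2_realI[of _ "\<lambda>x. - f' x * inverse (f x) * inverse (f x)"
          "\<lambda>x. - f'' x * inverse (f x) * inverse (f x)
            + 2 * f' x * f' x * inverse (f x) * inverse (f x) * inverse (f x)"])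
      (auto intro!: derivative_eq_intros continuous_intros f assms(2) simp: field_simps assms(2))
qed

lemmas C2_real_intros = C2_real_const C2_real_ident C2_real_add C2_real_mult C2_real_uminus
  C2_real_diff C2_real_power C2_real_inverse

text \<open>The delicate point is the kink at 0, where the difference quotient is at most
  \<open>|h| ^ (n + 1)\<close>. Leaving \<open>n\<close> free gives the first and the second
  derivative of the cube from one statement.\<close>

lemma has_real_derivative_pos_part_power:
  "((\<lambda>y. max 0 y ^ (n + 2)) has_real_derivative real (n + 2) * max 0 x ^ (n + 1)) (at x)"
proof -
  consider "x > 0" | "x < 0" | "x = 0" by linarith
  then show ?thesis
  proof cases
    case 1
    then have "\<forall>\<^sub>F y in nhds x. max 0 y ^ (n + 2) = y ^ (n + 2)"
      using eventually_nhds_in_open[of "{0<..}" x] by (auto elim!: eventually_mono)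
    then have "((\<lambda>y. max 0 y ^ (n + 2)) has_real_derivative real (n + 2) * max 0 x ^ (n + 1)) (at x)
      \<longleftrightarrow> ((\<lambda>y. y ^ (n + 2)) has_real_derivative real (n + 2) * x ^ (n + 1)) (at x)"
      using 1 by (intro DERIV_cong_ev) auto
    then show ?thesis by (auto intro!: derivative_eq_intros simp del: power_Suc)
  next
    case 2
    then have "\<forall>\<^sub>F y in nhds x. max 0 y ^ (n + 2) = 0"
      using eventually_nhds_in_open[of "{..<0}" x] by (auto elim!: eventually_mono)
    then have "((\<lambda>y. max 0 y ^ (n + 2)) has_real_derivative real (n + 2) * max 0 x ^ (n + 1)) (at x)
      \<longleftrightarrow> ((\<lambda>y. 0) has_real_derivative 0) (at x)"
      using 2 by (intro DERIV_cong_ev) auto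
    then show ?thesis by auto
  next
    case 3
    have "((\<lambda>h. \<bar>h\<bar> ^ (n + 1)) \<longlongrightarrow> \<bar>0\<bar> ^ (n + 1)) (at (0::real))"
      by (intro tendsto_intros)
    then have lim: "((\<lambda>h::real. \<bar>h\<bar> ^ (n + 1)) \<longlongrightarrow> 0) (at 0)" by simp
    have "\<bar>max 0 h ^ (n + 2) / h\<bar> \<le> \<bar>h\<bar> ^ (n + 1)" for h :: real
    proof (cases "h > 0")
      case False
      then have "\<bar>max 0 h ^ (n + 2) / h\<bar> = 0" by simp
      also have "0 \<le> \<bar>h\<bar> ^ (n + 1)" by (rule zero_le_power) simp
      finally show ?thesis .
    qed simp
    then have "((\<lambda>h::real. max 0 h ^ (n + 2) / h) \<longlongrightarrow> 0) (at 0)"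
      by (intro Lim_null_comparison[OF always_eventually lim]) auto
    then show ?thesis using 3 by (simp add: DERIV_def)
  qed
qed

text \<open>The cube is the lowest integer power of the positive part that is twice continuously
  differentiable. Composed with polynomials it yields cutoffs whose supports are known
  exactly.\<close>

lemma C2_real_pos_part_cube: "C2_real (\<lambda>y. max 0 y ^ 3)"
proof (rule C2_realI[of _ "\<lambda>y. 3 * max 0 y ^ 2" "\<lambda>y. 6 * max 0 y ^ 1"])
  show "((\<lambda>y. max 0 y ^ 3) has_real_derivative 3 * max 0 x ^ 2) (at x)" for x :: real
    using has_real_derivative_pos_part_power[of 1 x] by (simp add: eval_nat_numeral)
  show "((\<lambda>y. 3 * max 0 y ^ 2) has_real_derivative 6 * max 0 x ^ 1) (at x)" for x :: real
    using DERIV_cmult[OF has_real_derivative_pos_part_power[of 0 x], of 3] by (simp add: eval_nat_numeral)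
qed (intro continuous_intros)

section \<open>Test functions as finite sums of products\<close>

text \<open>For sums of products, mixed derivatives and joint continuity reduce to one variable. All
  test functions constructed below have this shape.\<close>

lemma tensor_sum_derivs:
  fixes a b a' b' :: "'i \<Rightarrow> real \<Rightarrow> real"
  assumes "\<And>i t. i \<in> I \<Longrightarrow> (a i has_real_derivative a' i t) (at t)"
    and "\<And>i x. i \<in> I \<Longrightarrow> (b i has_real_derivative b' i x) (at x)"
  shows "dt (\<lambda>(t, x). \<Sum>i\<in>I. a i t * b i x) = (\<lambda>(t, x). \<Sum>i\<in>I. a' i t * b i x)"
    and "dx (\<lambda>(t, x). \<Sum>i\<in>I. a i t * b i x) = (\<lambda>(t, x). \<Sum>i\<in>I. a i t * b' i x)"
    and "(\<And>i. i \<in> I \<Longrightarrow> continuous_on UNIV (a' i)) \<Longrightarrow>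
      (\<And>i. i \<in> I \<Longrightarrow> continuous_on UNIV (b' i)) \<Longrightarrow> C1_on S (\<lambda>(t, x). \<Sum>i\<in>I. a i t * b i x)"
proof -
  have t: "((\<lambda>s. \<Sum>i\<in>I. a i s * b i x) has_real_derivative (\<Sum>i\<in>I. a' i t * b i x)) (at t)" for t x
    by (rule DERIV_sum) (auto intro!: derivative_eq_intros assms)
  have x: "((\<lambda>y. \<Sum>i\<in>I. a i t * b i y) has_real_derivative (\<Sum>i\<in>I. a i t * b' i x)) (at x)" for t x
    by (rule DERIV_sum) (auto intro!: derivative_eq_intros assms)
  show 1: "dt (\<lambda>(t, x). \<Sum>i\<in>I. a i t * b i x) = (\<lambda>(t, x). \<Sum>i\<in>I. a' i t * b i x)"
    by (auto simp: dt_def fun_eq_iff intro!: DERIV_imp_deriv t)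
  show 2: "dx (\<lambda>(t, x). \<Sum>i\<in>I. a i t * b i x) = (\<lambda>(t, x). \<Sum>i\<in>I. a i t * b' i x)"
    by (auto simp: dx_def fun_eq_iff intro!: DERIV_imp_deriv x)
  assume c: "\<And>i. i \<in> I \<Longrightarrow> continuous_on UNIV (a' i)" "\<And>i. i \<in> I \<Longrightarrow> continuous_on UNIV (b' i)"
  have ab: "continuous_on UNIV (a i)" "continuous_on UNIV (b i)" if "i \<in> I" for i
    using assms that by (auto intro!: DERIV_continuous_on)
  have cont: "continuous_on S (\<lambda>(t, x). \<Sum>i\<in>I. f i t * g i x)"
    if "\<And>i. i \<in> I \<Longrightarrow> continuous_on UNIV (f i)" "\<And>i. i \<in> I \<Longrightarrow> continuous_on UNIV (g i)"
    for f g :: "'i \<Rightarrow> real \<Rightarrow> real"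
    unfolding split_beta
    by (intro continuous_on_sum continuous_on_mult continuous_on_compose2[OF that(1)]
        continuous_on_compose2[OF that(2)] continuous_intros) auto
  have "continuous_on S (\<lambda>(t, x). \<Sum>i\<in>I. a' i t * b i x)"
    "continuous_on S (\<lambda>(t, x). \<Sum>i\<in>I. a i t * b' i x)"
    by (rule cont; simp add: c ab)+
  moreover have "(\<lambda>s. \<Sum>i\<in>I. a i s * b i x) differentiable at t"
    "(\<lambda>y. \<Sum>i\<in>I. a i t * b i y) differentiable at x" for t x
    using t x real_differentiable_def by blast+
  ultimately show "C1_on S (\<lambda>(t, x). \<Sum>i\<in>I. a i t * b i x)"
    unfolding C1_on_def 1 2 by auto
qed

lemma C2_on_tensor_sum:
  fixes a b :: "'i \<Rightarrow> real \<Rightarrow> real"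
  assumes "\<And>i. i \<in> I \<Longrightarrow> C2_real (a i)" "\<And>i. i \<in> I \<Longrightarrow> C2_real (b i)"
  shows "C2_on S (\<lambda>(t, x). \<Sum>i\<in>I. a i t * b i x)"
proof -
  define P where "P f f' f'' \<longleftrightarrow> (\<forall>x. (f has_real_derivative f' x) (at x)) \<and>
     (\<forall>x. (f' has_real_derivative f'' x) (at x)) \<and> continuous_on UNIV f' \<and> continuous_on UNIV f''"
    for f f' f'' :: "real \<Rightarrow> real"
  have "\<exists>f' f''. P f f' f''" if "C2_real f" for f
    using C2_realE[OF that] unfolding P_def by metis
  then obtain D D2 where P: "\<And>f. C2_real f \<Longrightarrow> P f (D f) (D2 f)" by metis
  have a: "\<And>i x. i \<in> I \<Longrightarrow> (a i has_real_derivative D (a i) x) (at x)"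
    "\<And>i x. i \<in> I \<Longrightarrow> (D (a i) has_real_derivative D2 (a i) x) (at x)"
    "\<And>i. i \<in> I \<Longrightarrow> continuous_on UNIV (D (a i))" "\<And>i. i \<in> I \<Longrightarrow> continuous_on UNIV (D2 (a i))"
    using P[OF assms(1)] unfolding P_def by blast+
  have b: "\<And>i x. i \<in> I \<Longrightarrow> (b i has_real_derivative D (b i) x) (at x)"
    "\<And>i x. i \<in> I \<Longrightarrow> (D (b i) has_real_derivative D2 (b i) x) (at x)"
    "\<And>i. i \<in> I \<Longrightarrow> continuous_on UNIV (D (b i))" "\<And>i. i \<in> I \<Longrightarrow> continuous_on UNIV (D2 (b i))"
    using P[OF assms(2)] unfolding P_def by blast+
  have "C1_on S (\<lambda>(t, x). \<Sum>i\<in>I. a i t * b i x)"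
    by (rule tensor_sum_derivs(3)[OF a(1) b(1) a(3) b(3)])
  moreover have "C1_on S (\<lambda>(t, x). \<Sum>i\<in>I. D (a i) t * b i x)"
    by (rule tensor_sum_derivs(3)[OF a(2) b(1) a(4) b(3)])
  moreover have "C1_on S (\<lambda>(t, x). \<Sum>i\<in>I. a i t * D (b i) x)"
    by (rule tensor_sum_derivs(3)[OF a(1) b(2) a(3) b(4)])
  ultimately show ?thesis
    unfolding C2_on_def by (simp add: tensor_sum_derivs(1,2)[OF a(1) b(1)])
qed

lemma separable_test:
  assumes "C2_real A" "C2_real G"
  shows "C2_on S (\<lambda>(t, x). A x + G t)"
proof -
  \<comment> \<open>The index type is \<open>bool\<close>: \<open>True\<close> gives the summand
    \<open>1 * A x\<close>, \<open>False\<close> gives \<open>G t * 1\<close>.\<close>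
  have "C2_on S (\<lambda>(t, x). \<Sum>i\<in>UNIV. (if i then (\<lambda>t. 1) else G) t * (if i then A else (\<lambda>x. 1)) x)"
    using assms by (intro C2_on_tensor_sum) (auto intro: C2_real_const)
  then show ?thesis by (simp add: UNIV_bool add.commute)
qed

subsection \<open>Integrals\<close>

text \<open>The antiderivative \<open>- 1 / z\<close> settles the right half line, and reflection
  the left one.\<close>

lemma set_integrable_inverse_square:
  assumes r: "r > (0::real)"
  shows "set_integrable lborel (- {-r<..<r}) (\<lambda>z. 1 / z\<^sup>2)"
proof -
  have lim: "((\<lambda>x::real. - 1 / x) \<longlongrightarrow> 0) at_top"
    using tendsto_minus[OF tendsto_inverse_0_at_top[OF filterlim_ident]] by (simp add: inverse_eq_divide)
  have *: "(\<integral>\<^sup>+x. ennreal (1 / x\<^sup>2) * indicator {r..} x \<partial>lborel) = ennreal (0 - (- 1 / r))"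
    by (rule nn_integral_FTC_atLeast[OF _ _ _ lim])
      (use r in \<open>auto intro!: derivative_eq_intros simp: power2_eq_square\<close>)
  have 1: "set_integrable lborel {r..} (\<lambda>z. 1 / z\<^sup>2)"
    unfolding set_integrable_def
  proof (intro integrableI_nonneg)
    have "(\<integral>\<^sup>+x. ennreal (indicator {r..} x *\<^sub>R (1 / x\<^sup>2)) \<partial>lborel)
        = (\<integral>\<^sup>+x. ennreal (1 / x\<^sup>2) * indicator {r..} x \<partial>lborel)"
      by (intro nn_integral_cong) (simp split: split_indicator)
    with * show "(\<integral>\<^sup>+x. ennreal (indicator {r..} x *\<^sub>R (1 / x\<^sup>2)) \<partial>lborel) < \<infinity>"
      by simp
  qed auto
  have "integrable lborel (\<lambda>x. indicator {r..} (0 + (-1) * x) *\<^sub>R (1 / (0 + (-1) * x)\<^sup>2))"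
    by (rule lborel_integrable_real_affine) (use 1 in \<open>auto simp: set_integrable_def\<close>)
  then have "set_integrable lborel {..-r} (\<lambda>z. 1 / z\<^sup>2)"
    unfolding set_integrable_def
    by (rule back_subst[of "integrable lborel"]) (auto simp: indicator_def fun_eq_iff)
  from set_integrable_Un[OF 1 this] have "set_integrable lborel ({r..} \<union> {..-r}) (\<lambda>z. 1 / z\<^sup>2)"
    by simp
  moreover have "{r..} \<union> {..-r} = - {-r<..<r}" by auto
  ultimately show ?thesis by simp
qed

text \<open>If \<open>f\<close> is not integrable, its Lebesgue integral is 0.\<close>

lemma set_integral_mono_nonneg:
  fixes f g :: "'a \<Rightarrow> real"
  assumes "set_integrable M A g" "\<And>x. x \<in> A \<Longrightarrow> f x \<le> g x" "\<And>x. x \<in> A \<Longrightarrow> 0 \<le> g x"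
  shows "(LINT x:A|M. f x) \<le> (LINT x:A|M. g x)"
  using assms unfolding set_integrable_def set_lebesgue_integral_def
  by (intro integral_mono') (auto simp: indicator_def)

lemma set_integral_le_const:
  fixes f :: "real \<Rightarrow> real"
  assumes "a \<le> b" "A \<in> {{a<..<b}, {a..b}}" "\<And>x. x \<in> A \<Longrightarrow> f x \<le> C" "0 \<le> C"
  shows "(LINT x:A|lborel. f x) \<le> (b - a) * C"
proof -
  have A: "A \<in> sets lborel" "emeasure lborel A < \<infinity>" "measure lborel A = b - a"
    using assms(1,2) by (auto simp: emeasure_lborel_Ioo emeasure_lborel_Icc)
  have "(LINT x:A|lborel. f x) \<le> (LINT x:A|lborel. C)"
    using A assms(3,4) by (intro set_integral_mono_nonneg) (auto simp: set_integrable_def)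
  also have "\<dots> = (b - a) * C"
    using A by (simp add: set_lebesgue_integral_def)
  finally show ?thesis .
qed

text \<open>\<open>A\<close> may be smaller than the complement of the open interval, so cutting at
  an open or at a closed interval leads to the same constant on the right.\<close>

lemma nonlocal_le:
  fixes f :: "real \<Rightarrow> real"
  assumes "r > 0" "A \<subseteq> - {-r<..<r}" "A \<in> sets lborel" "\<And>z. z \<in> A \<Longrightarrow> f z \<le> B" "0 \<le> B"
  shows "(LINT z:A|lborel. f z / z\<^sup>2) \<le> B * (LINT z:(- {-r<..<r})|lborel. 1 / z\<^sup>2)"
proof -
  have i: "set_integrable lborel A (\<lambda>z. B * (1 / z\<^sup>2))"
    by (intro set_integrable_mult_right set_integrable_subset[OF set_integrable_inverse_square[OF assms(1)] assms(3,2)])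
  have "(LINT z:A|lborel. f z / z\<^sup>2) \<le> (LINT z:A|lborel. B * (1 / z\<^sup>2))"
    using i assms by (intro set_integral_mono_nonneg) (auto intro: divide_right_mono)
  also have "\<dots> \<le> (LINT z:(- {-r<..<r})|lborel. B * (1 / z\<^sup>2))"
    unfolding set_lebesgue_integral_def
  proof (rule integral_mono')
    show "integrable lborel (\<lambda>z. indicator (- {-r<..<r}) z *\<^sub>R (B * (1 / z\<^sup>2)))"
      using set_integrable_mult_right[OF set_integrable_inverse_square[OF assms(1)], of B]
      unfolding set_integrable_def .
  qed (use assms(2,5) in \<open>auto simp: indicator_def\<close>)
  finally show ?thesis unfolding set_integral_mult_right .
qed

section \<open>Second-order remainders and integrability of the two parts\<close>

text \<open>Two mean value estimates on the ball of radius \<open>|z|\<close> about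
  \<open>x\<close>: one for \<open>f'\<close>, then one for \<open>f\<close> minus its linear part.
  This loses only a factor 2 against Taylor's formula.\<close>

lemma C2_real_remainder_le:
  fixes f :: "real \<Rightarrow> real"
  assumes f': "\<And>x. (f has_real_derivative f' x) (at x)" "\<And>x. (f' has_real_derivative f'' x) (at x)"
    and C: "\<And>y. \<bar>y - x\<bar> \<le> \<bar>z\<bar> \<Longrightarrow> \<bar>f'' y\<bar> \<le> C"
  shows "\<bar>f (x + z) - f x - f' x * z\<bar> \<le> C * z\<^sup>2"
proof -
  define S where "S = cball x \<bar>z\<bar>"
  have S: "convex S" "x \<in> S" "x + z \<in> S" by (auto simp: S_def dist_real_def)
  have C': "\<bar>f'' y\<bar> \<le> C" if "y \<in> S" for y
    using C[of y] that by (simp add: S_def dist_real_def abs_minus_commute)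
  have *: "norm (f' y - f' x) \<le> C * \<bar>z\<bar>" if "y \<in> S" for y
  proof -
    have "norm (f' y - f' x) \<le> C * norm (y - x)"
      by (rule field_differentiable_bound[of S f' f''])
        (use S that C' in \<open>auto intro!: has_field_derivative_at_within[OF f'(2)]\<close>)
    also have "\<dots> \<le> C * \<bar>z\<bar>"
      using that C'[OF S(2)] by (intro mult_left_mono) (auto simp: S_def dist_real_def)
    finally show ?thesis .
  qed
  have "norm ((f (x + z) - f' x * (x + z)) - (f x - f' x * x)) \<le> C * \<bar>z\<bar> * norm ((x + z) - x)"
    by (rule field_differentiable_bound[of S "\<lambda>y. f y - f' x * y" "\<lambda>y. f' y - f' x"])
      (use S * in \<open>auto intro!: derivative_eq_intros has_field_derivative_at_within[OF f'(1)]\<close>)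
  then show ?thesis by (simp add: algebra_simps power2_eq_square)
qed

lemma C2_real_remainder_bound:
  assumes "C2_real f" "(f has_real_derivative d) (at x)"
  obtains C where "C \<ge> 0" "\<And>z. \<bar>z\<bar> \<le> r \<Longrightarrow> \<bar>(f (x + z) - f x - d * z) / z\<^sup>2\<bar> \<le> C"
proof -
  obtain f' f'' where f: "\<And>x. (f has_real_derivative f' x) (at x)"
    "\<And>x. (f' has_real_derivative f'' x) (at x)" "continuous_on UNIV f''"
    using C2_realE[OF assms(1)] by metis
  have d: "d = f' x" using assms(2) f(1) DERIV_unique by blast
  have "compact (f'' ` cball x r)"
    by (intro compact_continuous_image continuous_on_subset[OF f(3)]) auto
  then obtain C where C: "\<And>y. y \<in> cball x r \<Longrightarrow> \<bar>f'' y\<bar> \<le> C"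
    using compact_imp_bounded by (force simp: bounded_iff)
  have "\<bar>(f (x + z) - f x - d * z) / z\<^sup>2\<bar> \<le> \<bar>C\<bar>" if "\<bar>z\<bar> \<le> r" for z
  proof (cases "z = 0")
    case False
    have "\<bar>f (x + z) - f x - f' x * z\<bar> \<le> \<bar>C\<bar> * z\<^sup>2"
    proof (rule C2_real_remainder_le[OF f(1,2)])
      show "\<bar>f'' y\<bar> \<le> \<bar>C\<bar>" if "\<bar>y - x\<bar> \<le> \<bar>z\<bar>" for y
      proof -
        have "\<bar>f'' y\<bar> \<le> C"
          by (rule C) (use that \<open>\<bar>z\<bar> \<le> r\<close> in \<open>simp add: dist_real_def\<close>)
        then show ?thesis by linarith
      qed
    qed
    then show ?thesis using False d by (simp add: abs_divide field_simps)
  qed simp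
  then show thesis using that[of "\<bar>C\<bar>"] by auto
qed

lemma set_integrable_bounded_real:
  fixes f :: "real \<Rightarrow> real"
  assumes "f \<in> borel_measurable borel" "A \<in> sets borel" "A \<subseteq> {-a..a}"
    and "\<And>x. x \<in> A \<Longrightarrow> \<bar>f x\<bar> \<le> C"
  shows "set_integrable lborel A f"
  unfolding set_integrable_def
proof (rule integrableI_bounded_set_indicator)
  have "emeasure lborel A \<le> emeasure lborel {-a..a}"
    using assms(2,3) by (intro emeasure_mono) auto
  then show "emeasure lborel A < \<infinity>"
    using emeasure_lborel_Icc_eq[of "-a" a] by (auto simp: less_top[symmetric] top_unique split: if_splits)
qed (use assms in auto)

lemma set_integrable_nonlocal:
  fixes f :: "real \<Rightarrow> real"
  assumes "f \<in> borel_measurable borel" "r > 0" "A \<subseteq> - {-r<..<r}" "A \<in> sets borel"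
    and "\<And>z. \<bar>f z\<bar> \<le> B"
  shows "set_integrable lborel A (\<lambda>z. f z / z\<^sup>2)"
proof (rule set_integrable_bound)
  show "set_integrable lborel A (\<lambda>z. B * (1 / z\<^sup>2))"
    using assms(3,4)
    by (intro set_integrable_mult_right set_integrable_subset[OF set_integrable_inverse_square[OF assms(2)]]) auto
  show "set_borel_measurable lborel A (\<lambda>z. f z / z\<^sup>2)"
    using assms(1,4) unfolding set_borel_measurable_def by measurable
  have "\<bar>f z / z\<^sup>2\<bar> \<le> \<bar>B * (1 / z\<^sup>2)\<bar>" for z
    using assms(5)[of z] by (auto simp: abs_mult abs_divide intro!: divide_right_mono)
  then show "AE z in lborel. z \<in> A \<longrightarrow> norm (f z / z\<^sup>2) \<le> norm (B * (1 / z\<^sup>2))" by auto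
qed

lemma odd_integral_eq_0:
  fixes h :: "real \<Rightarrow> real"
  assumes "\<And>x. h (- x) = - h x"
  shows "(LINT x|lborel. h x) = 0"
  using lborel_integral_real_affine[of "-1" h 0] by (simp add: assms)

subsection \<open>Test functions that are quartic in space\<close>

text \<open>For nonzero \<open>z\<close> the quotient is the polynomial
  \<open>c * (6 * d^2 + 4 * d * z + z^2)\<close>, which explains the constants. At
  \<open>z = 0\<close> it is 0 by the convention for division.\<close>

lemma quartic_remainder_le:
  fixes c d z r :: real
  assumes "c \<ge> 0" "\<bar>d\<bar> \<le> 1" "\<bar>z\<bar> \<le> r"
  shows "(c * (d + z) ^ 4 - c * d ^ 4 - 4 * c * d ^ 3 * z) / z\<^sup>2 \<le> c * (6 + 4 * r + r\<^sup>2)"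
proof (cases "z = 0")
  case False
  have "(c * (d + z) ^ 4 - c * d ^ 4 - 4 * c * d ^ 3 * z) / z\<^sup>2 = c * (6 * d\<^sup>2 + 4 * d * z + z\<^sup>2)"
    using False by (simp add: field_simps) algebra
  also have "\<dots> \<le> c * (6 + 4 * r + r\<^sup>2)"
  proof (intro mult_left_mono add_mono assms(1))
    show "6 * d\<^sup>2 \<le> 6" using assms(2) by (simp add: abs_square_le_1)
    have "\<bar>d * z\<bar> \<le> 1 * r" unfolding abs_mult using assms by (intro mult_mono) auto
    then show "4 * d * z \<le> 4 * r" by linarith
    show "z\<^sup>2 \<le> r\<^sup>2" using assms(3) by (metis abs_ge_zero power2_abs power_mono)
  qed
  finally show ?thesis .
qed (use assms in auto)

lemma subsolution_bounded:
  assumes "subsolution \<rho> u"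
  obtains B where "B \<ge> 0" "\<And>p. p \<in> Q \<Longrightarrow> \<bar>u p\<bar> \<le> B"
proof -
  obtain B where "\<forall>p\<in>Q. \<bar>u p\<bar> \<le> B"
    using assms by (auto simp: subsolution_def bounded_iff)
  then show thesis by (intro that[of "\<bar>B\<bar>"]) force+
qed

text \<open>The gradient of the test function is \<open>4 * c * (x - y)^3\<close>, and the bracket
  in \<open>H\<close> is at most a constant because the quartic has a bounded remainder and
  \<open>u\<close> is bounded. At \<open>x = y\<close> the quartic clause gives the same inequality
  with right side 0. \<open>K\<close> is uniform in the centre and in the quadratic time profile, so
  that barriers and frozen penalties are both covered.\<close>

lemma subsolution_quartic_test:
  assumes u: "subsolution \<rho> u" and \<rho>: "\<rho> > 0" and c: "c > 0"
  obtains K where "K \<ge> 0"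
    "\<And>y a b t x. t > 0 \<Longrightarrow> \<bar>x - y\<bar> \<le> 1 \<Longrightarrow>
      (\<And>s z. s > 0 \<Longrightarrow> u (s, z) - (c * (z - y) ^ 4 + (a * s\<^sup>2 + b * s))
         \<le> u (t, x) - (c * (x - y) ^ 4 + (a * t\<^sup>2 + b * t))) \<Longrightarrow>
      2 * a * t + b \<le> K * \<bar>x - y\<bar> ^ 3"
proof -
  obtain B where B: "B \<ge> 0" "\<And>p. p \<in> Q \<Longrightarrow> \<bar>u p\<bar> \<le> B"
    using subsolution_bounded[OF u] by blast
  define J where "J = (LINT z:(- {-\<rho><..<\<rho>})|lborel. 1 / z\<^sup>2)"
  have J: "J \<ge> 0" unfolding J_def set_lebesgue_integral_def by (intro integral_nonneg_AE) auto
  define C where "C = c * (6 + 4 * \<rho> + \<rho>\<^sup>2)"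
  have C: "C \<ge> 0" using c \<rho> by (simp add: C_def)
  define K where "K = 4 * c * (2 * \<rho> * C + 2 * B * J)"
  have "K \<ge> 0" using B J C \<rho> c by (simp add: K_def)
  moreover have "2 * a * t + b \<le> K * \<bar>x - y\<bar> ^ 3" if t: "t > 0" and xy: "\<bar>x - y\<bar> \<le> 1"
    and max: "\<And>s z. s > 0 \<Longrightarrow> u (s, z) - (c * (z - y) ^ 4 + (a * s\<^sup>2 + b * s))
         \<le> u (t, x) - (c * (x - y) ^ 4 + (a * t\<^sup>2 + b * t))" for y a b t x
  proof -
    define \<phi> where "\<phi> = (\<lambda>(t, x). c * (x - y) ^ 4 + (a * t\<^sup>2 + b * t))"
    have C2: "C2_on Q \<phi>"
      unfolding \<phi>_def by (intro separable_test C2_real_intros)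
    have dt: "dt \<phi> (t, x) = 2 * a * t + b"
      by (auto simp: dt_def \<phi>_def intro!: DERIV_imp_deriv derivative_eq_intros)
    have dx: "dx \<phi> (t, x) = 4 * c * (x - y) ^ 3"
      by (auto simp: dx_def \<phi>_def intro!: DERIV_imp_deriv derivative_eq_intros)
    have p: "(t, x) \<in> Q" using t by (simp add: Q_def)
    have "\<forall>q\<in>Q. u q - \<phi> q \<le> u (t, x) - \<phi> (t, x)"
      using max by (auto simp: Q_def \<phi>_def)
    then have *: "dx \<phi> (t, x) \<noteq> 0 \<longrightarrow> dt \<phi> (t, x) \<le> H \<rho> \<phi> u (t, x)"
      "quartic_at x \<phi> \<longrightarrow> dt \<phi> (t, x) \<le> 0"
      using u C2 p unfolding subsolution_def by blast+
    show ?thesis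
    proof (cases "x = y")
      case True
      have "\<forall>(s, z)\<in>Q. \<phi> (s, z) = c * \<bar>z - x\<bar> ^ 4 + (a * s\<^sup>2 + b * s)"
        by (auto simp: \<phi>_def True)
      then have "quartic_at x \<phi>" unfolding quartic_at_def by (intro exI)
      then show ?thesis using * dt True by simp
    next
      case False
      then have "dx \<phi> (t, x) \<noteq> 0" using dx c by simp
      then have "2 * a * t + b \<le> H \<rho> \<phi> u (t, x)" using * dt by simp
      also have "\<dots> \<le> \<bar>dx \<phi> (t, x)\<bar> * (2 * \<rho> * C + 2 * B * J)"
        unfolding H_def prod.case
      proof (intro mult_left_mono add_mono)
        have "(LINT z:{-\<rho><..<\<rho>}|lborel. (\<phi> (t, x + z) - \<phi> (t, x) - dx \<phi> (t, x) * z) / z\<^sup>2)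
          \<le> (\<rho> - - \<rho>) * C"
        proof (rule set_integral_le_const)
          fix z assume "z \<in> {-\<rho><..<\<rho>}"
          then have "\<bar>z\<bar> \<le> \<rho>" by auto
          from quartic_remainder_le[OF less_imp_le[OF c] xy this]
          show "(\<phi> (t, x + z) - \<phi> (t, x) - dx \<phi> (t, x) * z) / z\<^sup>2 \<le> C"
            unfolding dx by (simp add: \<phi>_def C_def algebra_simps)
        qed (use \<rho> C in auto)
        then show "(LINT z:{-\<rho><..<\<rho>}|lborel. (\<phi> (t, x + z) - \<phi> (t, x) - dx \<phi> (t, x) * z) / z\<^sup>2)
          \<le> 2 * \<rho> * C" by simp
        show "(LINT z:(- {-\<rho><..<\<rho>})|lborel. (u (t, x + z) - u (t, x)) / z\<^sup>2) \<le> 2 * B * J"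
          unfolding J_def
        proof (rule nonlocal_le[OF \<rho>])
          show "u (t, x + z) - u (t, x) \<le> 2 * B" for z
            using B(2)[of "(t, x + z)"] B(2)[of "(t, x)"] t by (simp add: Q_def)
        qed (use B in auto)
      qed simp
      also have "\<dots> = K * \<bar>x - y\<bar> ^ 3"
        unfolding dx K_def using c by (simp add: abs_mult power_abs)
      finally show ?thesis .
    qed
  qed
  ultimately show thesis by (rule that)
qed

text \<open>Extending \<open>u\<close> by the initial datum keeps it upper semicontinuous, so that a positive maximum
  of \<open>u\<close> minus a barrier is attained, and not at time 0.\<close>

lemma subsolution_initial_bound:
  assumes u: "subsolution \<rho> u" and \<rho>: "\<rho> > 0"
    and u0: "bounded (range u0)" "uniformly_continuous_on UNIV u0"
    and init: "\<And>x a. u0 x < a \<Longrightarrow> \<forall>\<^sub>F p in at (0, x) within Q. u p < a"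
    and \<delta>: "\<delta> > 0"
  obtains K where "K \<ge> 0" "\<And>t x. t > 0 \<Longrightarrow> u (t, x) \<le> u0 x + \<delta> + K * t"
proof -
  obtain B where B: "B \<ge> 0" "\<And>p. p \<in> Q \<Longrightarrow> \<bar>u p\<bar> \<le> B"
    using subsolution_bounded[OF u] by blast
  obtain B0' where "\<forall>x. \<bar>u0 x\<bar> \<le> B0'"
    using u0(1) by (auto simp: bounded_iff)
  then obtain B0 where B0: "B0 \<ge> 0" "\<And>x. \<bar>u0 x\<bar> \<le> B0"
    by (meson abs_ge_zero order_trans)
  obtain d where d: "d > 0" "\<And>x y. \<bar>x - y\<bar> < d \<Longrightarrow> \<bar>u0 x - u0 y\<bar> < \<delta>"
    using u0(2) \<delta> unfolding uniformly_continuous_on_def by (auto simp: dist_real_def)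
  \<comment> \<open>\<open>B + B0\<close> confines the relevant superlevel set to
    \<open>|x - x1| \<le> 1\<close>. The term with \<open>d ^ 4\<close> makes the quartic dominate
    the oscillation of \<open>u0\<close> beyond distance \<open>d\<close>. The 1 makes
    \<open>c\<close> positive.\<close>
  define c where "c = B + B0 + 1 + 2 * B0 / d ^ 4"
  have c: "c > 0" "c \<ge> B + B0" "c \<ge> 2 * B0 / d ^ 4"
    using B B0 d by (auto simp: c_def add_nonneg_pos add_pos_nonneg)
  have quart: "u0 x \<le> u0 y + \<delta> + c * (x - y) ^ 4" for x y
  proof (cases "\<bar>x - y\<bar> < d")
    case True
    have "0 \<le> c * (x - y) ^ 4" using c by simp
    then show ?thesis using d(2)[OF True] by linarith
  next
    case False
    then have "d ^ 4 \<le> \<bar>x - y\<bar> ^ 4" using d(1) by (intro power_mono) auto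
    then have "2 * B0 / d ^ 4 * d ^ 4 \<le> c * (x - y) ^ 4"
      using c B0 by (intro mult_mono) auto
    then have "2 * B0 \<le> c * (x - y) ^ 4" using d(1) by simp
    then show ?thesis using B0(2)[of x] B0(2)[of y] \<delta> by linarith
  qed
  obtain K0 where K0: "K0 \<ge> 0"
    "\<And>y a b t x. t > 0 \<Longrightarrow> \<bar>x - y\<bar> \<le> 1 \<Longrightarrow>
      (\<And>s z. s > 0 \<Longrightarrow> u (s, z) - (c * (z - y) ^ 4 + (a * s\<^sup>2 + b * s))
         \<le> u (t, x) - (c * (x - y) ^ 4 + (a * t\<^sup>2 + b * t))) \<Longrightarrow>
      2 * a * t + b \<le> K0 * \<bar>x - y\<bar> ^ 3"
    using subsolution_quartic_test[OF u \<rho> c(1)] by blast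
  \<comment> \<open>One more than the slope \<open>K0\<close> permitted at a maximum with
    \<open>|x - x1| \<le> 1\<close>, whence the contradiction; \<open>K \<ge> 1\<close> also bounds
    the time of a maximizer.\<close>
  define K where "K = K0 + 1"
  define S :: "(real \<times> real) set" where "S = {0..} \<times> UNIV"
  define u' where "u' = (\<lambda>(t, x). if t > 0 then u (t, x) else u0 x)"
  have usc: "usc_on S u'"
  proof (rule usc_onI)
    fix p a assume p: "p \<in> S" "u' p < a"
    obtain t x where tx: "p = (t, x)" by force
    show "\<exists>U. open U \<and> p \<in> U \<and> (\<forall>q\<in>U \<inter> S. u' q < a)"
    proof (cases "t > 0")
      case True
      then have "\<exists>U. open U \<and> (t, x) \<in> U \<and> (\<forall>q\<in>U \<inter> Q. u q < a)"
        using u p tx by (intro usc_onD) (auto simp: subsolution_def u'_def Q_def)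
      then obtain U where U: "open U" "(t, x) \<in> U" "\<forall>q\<in>U \<inter> Q. u q < a" by blast
      show ?thesis
        using U True open_Q tx
        by (intro exI[of _ "U \<inter> Q"]) (auto simp: u'_def Q_def open_Int)
    next
      case False
      then have t: "t = 0" using p tx by (simp add: S_def)
      have "u0 x < a" using p tx t by (simp add: u'_def)
      from init[OF this] obtain U where U: "open U" "(0, x) \<in> U" "\<forall>q\<in>U. q \<noteq> (0, x) \<longrightarrow> q \<in> Q \<longrightarrow> u q < a"
        by (auto simp: eventually_at_topological)
      have "open {y. u0 y < a}"
        using uniformly_continuous_imp_continuous[OF u0(2)] by (intro open_Collect_less continuous_intros) auto
      then have "open (U \<inter> UNIV \<times> {y. u0 y < a})" using U(1) by (intro open_Int open_Times) auto
      moreover have "u' q < a" if "q \<in> (U \<inter> UNIV \<times> {y. u0 y < a}) \<inter> S" for q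
        using that U(3) by (auto simp: u'_def Q_def S_def)
      ultimately show ?thesis using U(2) \<open>u0 x < a\<close> tx t by blast
    qed
  qed
  have "u (t1, x1) \<le> u0 x1 + \<delta> + K * t1" if t1: "t1 > 0" for t1 x1
  proof (rule ccontr)
    assume neg: "\<not> ?thesis"
    define f where "f = (\<lambda>p. u' p + - (u0 x1 + \<delta> + c * (snd p - x1) ^ 4 + K * fst p))"
    have f1: "f (t1, x1) > 0" using neg t1 by (simp add: f_def u'_def)
    define L where "L = {0..B + B0} \<times> {x1 - 1..x1 + 1}"
    have "usc_on S f"
      unfolding f_def by (intro usc_on_add usc continuous_on_imp_usc_on continuous_intros)
    moreover have "compact L" "L \<subseteq> S" "(t1, x1) \<in> S"
      using t1 by (auto simp: S_def L_def intro!: compact_Times)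
    moreover have "p \<in> L" if "p \<in> S" "f (t1, x1) \<le> f p" for p
    proof -
      obtain t x where p: "p = (t, x)" by force
      have t: "t \<ge> 0" using that p by (simp add: S_def)
      have pos: "0 < f p" using that f1 by linarith
      \<comment> \<open>At time 0 the extended function equals \<open>u0\<close>, which
        \<open>quart\<close> keeps below the barrier.\<close>
      then have "t \<noteq> 0" using quart[of x x1] p by (auto simp: f_def u'_def)
      with t have t: "t > 0" by simp
      have *: "c * (x - x1) ^ 4 + K * t < B + B0"
        using pos p t B(2)[of "(t, x)"] B0(2)[of x1] \<delta> by (simp add: f_def u'_def Q_def abs_le_iff)
      have "t \<le> K * t" using t K0(1) by (simp add: K_def algebra_simps)
      moreover have "0 \<le> c * (x - x1) ^ 4" using c(1) by simp
      ultimately have "t \<le> B + B0" "c * (x - x1) ^ 4 \<le> c * 1"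
        using * t c(2) by linarith+
      then have "t \<le> B + B0" "\<bar>x - x1\<bar> ^ 4 \<le> 1"
        using c(1) by (simp_all add: mult_le_cancel_left_pos)
      then show ?thesis using p t power_le_one_iff[of "\<bar>x - x1\<bar>" 4] by (auto simp: L_def)
    qed
    ultimately obtain p where p: "p \<in> L" "f (t1, x1) \<le> f p" "\<forall>q\<in>S. f q \<le> f p"
      using usc_on_attains_sup_superlevel[of L S f "(t1, x1)"] by blast
    obtain t x where tx: "p = (t, x)" by force
    have "t \<noteq> 0"
      using p(2) f1 quart[of x x1] tx by (auto simp: f_def u'_def)
    then have t: "t > 0" "\<bar>x - x1\<bar> \<le> 1" using p(1) tx by (auto simp: L_def)
    have "2 * 0 * t + K \<le> K0 * \<bar>x - x1\<bar> ^ 3"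
    proof (rule K0(2)[OF t])
      show "u (s, z) - (c * (z - x1) ^ 4 + (0 * s\<^sup>2 + K * s))
        \<le> u (t, x) - (c * (x - x1) ^ 4 + (0 * t\<^sup>2 + K * t))" if "s > 0" for s z
        using bspec[OF p(3), of "(s, z)"] that t by (simp add: S_def f_def tx u'_def)
    qed
    also have "\<dots> \<le> K0 * 1"
      using t(2) K0(1) by (intro mult_left_mono power_le_one) auto
    finally show False by (simp add: K_def)
  qed
  moreover have "K \<ge> 0" using K0 by (simp add: K_def)
  ultimately show thesis using that by blast
qed

subsection \<open>Reducing the radius of the singular part\<close>

text \<open>Sup-convolution in space over a thin time slab, followed by polynomial approximation.\<close>

lemma usc_polynomial_approximation:
  assumes usc: "usc_on Q u" and B: "\<And>p. p \<in> Q \<Longrightarrow> \<bar>u p\<bar> \<le> B" and t0: "t0 > 0"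
  obtains p :: "nat \<Rightarrow> real \<Rightarrow> real" where
    "\<And>n. real_polynomial_function (p n)"
    "\<And>n t x. t > 0 \<Longrightarrow> \<bar>t - t0\<bar> \<le> 1 / (real n + 1) \<Longrightarrow> \<bar>x - x0\<bar> \<le> L \<Longrightarrow> u (t, x) \<le> p n x"
    "\<And>n x. \<bar>x - x0\<bar> \<le> L \<Longrightarrow> \<bar>p n x\<bar> \<le> B + 2"
    "\<And>x. \<bar>x - x0\<bar> \<le> L \<Longrightarrow> (\<lambda>n. p n x) \<longlonglongrightarrow> u (t0, x)"
proof -
  \<comment> \<open>The supremum over a slab of times makes \<open>U n\<close>, a function of
    \<open>x\<close> alone, dominate \<open>u\<close> at all times within \<open>1 / (n + 1)\<close>
    of \<open>t0\<close>. The slope \<open>n + 1\<close> makes \<open>U n\<close> Lipschitz in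
    \<open>x\<close>.\<close>
  define P where "P n = {q :: real \<times> real. fst q > 0 \<and> \<bar>fst q - t0\<bar> \<le> 1 / (real n + 1)}" for n :: nat
  define U where "U n x = (SUP q\<in>P n. u q - (real n + 1) * \<bar>x - snd q\<bar>)" for n x
  have PQ: "P n \<subseteq> Q" for n by (auto simp: P_def Q_def)
  have t0P: "(t0, x) \<in> P n" for n x using t0 by (simp add: P_def)
  have le_B: "u q - (real n + 1) * \<bar>x - snd q\<bar> \<le> B" if "q \<in> P n" for n x q
  proof -
    have "0 \<le> (real n + 1) * \<bar>x - snd q\<bar>" by simp
    moreover have "\<bar>u q\<bar> \<le> B" using B that PQ by blast
    ultimately show ?thesis by linarith
  qed
  have bdd: "bdd_above ((\<lambda>q. u q - (real n + 1) * \<bar>x - snd q\<bar>) ` P n)" for n x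
    using le_B by (auto intro!: bdd_aboveI2)
  have ge: "u (t, x) \<le> U n x" if "t > 0" "\<bar>t - t0\<bar> \<le> 1 / (real n + 1)" for n t x
    unfolding U_def using that by (intro cSUP_upper2[OF bdd, of "(t, x)"]) (auto simp: P_def)
  have ge_B: "- B \<le> U n x" for n x
    using ge[of t0 n x] B[of "(t0, x)"] t0 by (auto simp: Q_def)
  have U_le: "U n x \<le> a" if "\<And>q. q \<in> P n \<Longrightarrow> u q - (real n + 1) * \<bar>x - snd q\<bar> \<le> a" for n x a
    unfolding U_def using that t0P[of _ n] by (intro cSUP_least) blast+
  have U_le_B: "U n x \<le> B" for n x by (rule U_le) (rule le_B)
  have lip: "U n x \<le> U n y + (real n + 1) * \<bar>x - y\<bar>" for n x y
  proof (rule U_le)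
    fix q assume q: "q \<in> P n"
    have "u q - (real n + 1) * \<bar>y - snd q\<bar> \<le> U n y"
      unfolding U_def using q by (intro cSUP_upper bdd)
    moreover have "(real n + 1) * \<bar>y - snd q\<bar> \<le> (real n + 1) * (\<bar>x - y\<bar> + \<bar>x - snd q\<bar>)"
      by (intro mult_left_mono) auto
    ultimately show "u q - (real n + 1) * \<bar>x - snd q\<bar> \<le> U n y + (real n + 1) * \<bar>x - y\<bar>"
      by (simp add: algebra_simps)
  qed
  have cont: "continuous_on X (U n)" for n X
  proof (rule lipschitz_on_continuous_on)
    show "(real n + 1)-lipschitz_on X (U n)"
    proof (rule lipschitz_onI)
      show "dist (U n x) (U n y) \<le> (real n + 1) * dist x y" for x y
        using lip[of n x y] lip[of n y x] by (simp add: dist_real_def abs_le_iff abs_minus_commute)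
    qed simp
  qed
  \<comment> \<open>The target is raised by \<open>1 / (n + 1)\<close> and approximated within the
    same tolerance, so the polynomial lies above \<open>U n\<close> and exceeds it by at most
    \<open>2 / (n + 1)\<close>.\<close>
  have "\<exists>g. real_polynomial_function g \<and>
    (\<forall>x\<in>{x0 - L..x0 + L}. \<bar>(U n x + 1 / (real n + 1)) - g x\<bar> < 1 / (real n + 1))" for n
  proof -
    have "continuous_on {x0 - L..x0 + L} (\<lambda>x. U n x + 1 / (real n + 1))"
      by (intro continuous_on_add cont continuous_on_const)
    moreover have "0 < 1 / (real n + 1)" by simp
    ultimately obtain g where "real_polynomial_function g"
      "\<And>x. x \<in> {x0 - L..x0 + L} \<Longrightarrow> \<bar>(U n x + 1 / (real n + 1)) - g x\<bar> < 1 / (real n + 1)"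
      using Stone_Weierstrass_real_polynomial_function[of "{x0 - L..x0 + L}"
          "\<lambda>x. U n x + 1 / (real n + 1)" "1 / (real n + 1)"] by blast
    then show ?thesis by blast
  qed
  then obtain p where p: "\<And>n. real_polynomial_function (p n)"
    "\<And>n x. x \<in> {x0 - L..x0 + L} \<Longrightarrow> \<bar>(U n x + 1 / (real n + 1)) - p n x\<bar> < 1 / (real n + 1)"
    by metis
  have in_iff: "x \<in> {x0 - L..x0 + L} \<longleftrightarrow> \<bar>x - x0\<bar> \<le> L" for x by auto
  have p_ge: "U n x \<le> p n x" and p_le: "p n x \<le> U n x + 2 / (real n + 1)" if "\<bar>x - x0\<bar> \<le> L" for n x
  proof -
    have "2 / (real n + 1) = 1 / (real n + 1) + 1 / (real n + 1)" by (simp add: field_simps)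
    then show "U n x \<le> p n x" "p n x \<le> U n x + 2 / (real n + 1)"
      using p(2)[of x n] that[folded in_iff] by linarith+
  qed
  have "(\<lambda>n. p n x) \<longlonglongrightarrow> u (t0, x)" if x: "\<bar>x - x0\<bar> \<le> L" for x
  proof (rule tendsto_sandwich[where f = "\<lambda>n. u (t0, x)" and h = "\<lambda>n. U n x + 2 / (real n + 1)"])
    show "\<forall>\<^sub>F n in sequentially. u (t0, x) \<le> p n x"
    proof (intro always_eventually allI)
      fix n
      have "u (t0, x) \<le> U n x" by (rule ge) (use t0 in auto)
      then show "u (t0, x) \<le> p n x" using p_ge[OF x, of n] by linarith
    qed
    show "\<forall>\<^sub>F n in sequentially. p n x \<le> U n x + 2 / (real n + 1)"
      using p_le[OF x] by simp
    have U_lim: "(\<lambda>n. U n x) \<longlonglongrightarrow> u (t0, x)"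
    proof (rule order_tendstoI)
      fix a assume "a < u (t0, x)"
      moreover have "u (t0, x) \<le> U n x" for n by (rule ge) (use t0 in auto)
      ultimately show "\<forall>\<^sub>F n in sequentially. a < U n x"
        by (intro always_eventually allI) (rule less_le_trans)
    next
      fix a assume a: "u (t0, x) < a"
      obtain a' where a': "u (t0, x) < a'" "a' < a" using dense[OF a] by blast
      have "(t0, x) \<in> Q" using t0 by (simp add: Q_def)
      from usc_onD[OF usc this a'(1)] obtain V where V: "open V" "(t0, x) \<in> V" "\<forall>q\<in>V \<inter> Q. u q < a'"
        by blast
      obtain e where e: "e > 0" "ball (t0, x) e \<subseteq> V"
        using V(1,2) by (meson open_contains_ball)
      define d where "d = e / 2"
      have d: "d > 0" using e by (simp add: d_def)
      have near: "u q < a'" if "q \<in> Q" "\<bar>fst q - t0\<bar> < d" "\<bar>snd q - x\<bar> < d" for q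
      proof -
        have "dist (t0, x) q \<le> \<bar>fst q - t0\<bar> + \<bar>snd q - x\<bar>"
          using sqrt_sum_squares_le_sum_abs[of "fst q - t0" "snd q - x"]
          by (simp add: dist_prod_def dist_real_def power2_commute)
        then have "q \<in> ball (t0, x) e" using that by (simp add: d_def)
        then show ?thesis using V(3) e(2) that(1) by blast
      qed
      \<comment> \<open>\<open>1 / d\<close> puts the slab inside the window where
        \<open>u < a'\<close>; \<open>2 * B / d\<close> makes the slope penalty outside the window
        outweigh the whole range of \<open>u\<close>.\<close>
      obtain N :: nat where N: "real N > max (1 / d) (2 * B / d)" using reals_Archimedean2 by blast
      have "U n x \<le> a'" if "n \<ge> N" for n
      proof (rule U_le)
        fix q assume q: "q \<in> P n"
        have n: "real n + 1 > 1 / d" "real n + 1 > 2 * B / d" using N that by auto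
        show "u q - (real n + 1) * \<bar>x - snd q\<bar> \<le> a'"
        proof (cases "\<bar>x - snd q\<bar> < d")
          case True
          have "1 / (real n + 1) < d" using n(1) d by (simp add: field_simps)
          then have "u q < a'"
            using near[of q] q PQ True by (auto simp: P_def abs_minus_commute)
          moreover have "0 \<le> (real n + 1) * \<bar>x - snd q\<bar>" by simp
          ultimately show ?thesis by linarith
        next
          case False
          then have "(real n + 1) * d \<le> (real n + 1) * \<bar>x - snd q\<bar>"
            by (intro mult_left_mono) auto
          moreover have "2 * B \<le> (real n + 1) * d" using n(2) d by (simp add: field_simps)
          moreover have "u q \<le> B" "- B \<le> u (t0, x)"
            using B[of q] B[of "(t0, x)"] q PQ[of n] t0 by (auto simp: Q_def abs_le_iff)
          ultimately show ?thesis using a'(1) by linarith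
        qed
      qed
      then show "\<forall>\<^sub>F n in sequentially. U n x < a"
        using a'(2) unfolding eventually_sequentially by (meson le_less_trans)
    qed
    have "(\<lambda>n. 2 * inverse (real (Suc n))) \<longlonglongrightarrow> 2 * 0"
      by (intro tendsto_intros LIMSEQ_inverse_real_of_nat)
    then have "(\<lambda>n. 2 / (real n + 1)) \<longlonglongrightarrow> 0" by (simp add: field_simps)
    from tendsto_add[OF U_lim this] show "(\<lambda>n. U n x + 2 / (real n + 1)) \<longlonglongrightarrow> u (t0, x)" by simp
  qed simp
  moreover have "u (t, x) \<le> p n x" if "t > 0" "\<bar>t - t0\<bar> \<le> 1 / (real n + 1)" "\<bar>x - x0\<bar> \<le> L" for n t x
    using ge[OF that(1,2)] p_ge[OF that(3)] by (rule order_trans)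
  moreover have "\<bar>p n x\<bar> \<le> B + 2" if "\<bar>x - x0\<bar> \<le> L" for n x
  proof -
    have "2 / (real n + 1) \<le> 2" by (simp add: field_simps)
    then show ?thesis
      using p_ge[OF that, of n] p_le[OF that, of n] U_le_B[of n x] ge_B[of n x] by linarith
  qed
  ultimately show thesis using that[of p] p(1) by blast
qed

text \<open>Away from \<open>x0\<close> the test function is replaced near time \<open>t0\<close> by smooth functions above \<open>u\<close>
  that converge to \<open>u (t0, \<cdot>)\<close>. The first-order term contributes nothing on the annulus by oddness.\<close>

lemma subsolution_small_radius:
  assumes u: "subsolution \<rho> u" and r: "0 < r" "r < \<rho>" and A: "C2_real A" and G: "C2_real G"
    and d: "(A has_real_derivative d) (at x0)" "d \<noteq> 0" and g: "(G has_real_derivative g) (at t0)"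
    and t0: "t0 > 0"
    and max: "\<And>s z. s > 0 \<Longrightarrow> u (s, z) - (A z + G s) \<le> u (t0, x0) - (A x0 + G t0)"
  shows "g \<le> \<bar>d\<bar> * ((LINT z:{-r..r}|lborel. (A (x0 + z) - A x0 - d * z) / z\<^sup>2)
    + (LINT z:(- {-r..r})|lborel. (u (t0, x0 + z) - u (t0, x0)) / z\<^sup>2))"
proof -
  obtain B where B: "B \<ge> 0" "\<And>p. p \<in> Q \<Longrightarrow> \<bar>u p\<bar> \<le> B"
    using subsolution_bounded[OF u] by blast
  have usc: "usc_on Q u" using u by (simp add: subsolution_def)
  obtain p where p: "\<And>n. real_polynomial_function (p n)"
    "\<And>n t x. t > 0 \<Longrightarrow> \<bar>t - t0\<bar> \<le> 1 / (real n + 1) \<Longrightarrow> \<bar>x - x0\<bar> \<le> 2 * \<rho> \<Longrightarrow> u (t, x) \<le> p n x"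
    "\<And>n x. \<bar>x - x0\<bar> \<le> 2 * \<rho> \<Longrightarrow> \<bar>p n x\<bar> \<le> B + 2"
    "\<And>x. \<bar>x - x0\<bar> \<le> 2 * \<rho> \<Longrightarrow> (\<lambda>n. p n x) \<longlonglongrightarrow> u (t0, x)"
    using usc_polynomial_approximation[OF usc B(2) t0] by blast
  \<comment> \<open>\<open>D\<close> is the constant that makes the test function touch
    \<open>u\<close> at \<open>(t0, x0)\<close>. Next, \<open>q\<close> is positive exactly on the
    annulus \<open>r < |x - x0| < 2 * \<rho>\<close>, and \<open>\<eta> n\<close> increases to its
    indicator. \<open>T n\<close> equals 1 at \<open>t0\<close> and is supported in the slab where
    \<open>p n\<close> dominates \<open>u\<close>.\<close>
  define D where "D = u (t0, x0) - A x0 - G t0"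
  define q where "q x = max 0 ((x - x0)\<^sup>2 - r\<^sup>2) ^ 3 * max 0 (4 * \<rho>\<^sup>2 - (x - x0)\<^sup>2) ^ 3" for x
  define \<eta> where "\<eta> n x = real n * q x * inverse (1 + real n * q x)" for n x
  define T where "T n t = max 0 (1 - (real n + 1)\<^sup>2 * (t - t0)\<^sup>2) ^ 3" for n :: nat and t
  define \<phi> where "\<phi> n = (\<lambda>(t, x). A x + G t + D + T n t * \<eta> n x * (p n x - (A x + G t + D)))" for n
  have q_nonneg: "q x \<ge> 0" for x by (simp add: q_def)
  have q0: "q x = 0" if "\<bar>x - x0\<bar> \<le> r \<or> 2 * \<rho> \<le> \<bar>x - x0\<bar>" for x
  proof -
    have "\<bar>x - x0\<bar>\<^sup>2 \<le> r\<^sup>2 \<or> (2 * \<rho>)\<^sup>2 \<le> \<bar>x - x0\<bar>\<^sup>2"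
      using that r power_mono[of "\<bar>x - x0\<bar>" r 2] power_mono[of "2 * \<rho>" "\<bar>x - x0\<bar>" 2] by auto
    then show ?thesis by (auto simp: q_def power_mult_distrib)
  qed
  have q_pos: "q x > 0" if "r < \<bar>x - x0\<bar>" "\<bar>x - x0\<bar> < 2 * \<rho>" for x
  proof -
    have "\<bar>r\<bar> < \<bar>x - x0\<bar>" "\<bar>x - x0\<bar> < \<bar>2 * \<rho>\<bar>" using that r by auto
    then have "r\<^sup>2 < (x - x0)\<^sup>2" "(x - x0)\<^sup>2 < (2 * \<rho>)\<^sup>2"
      by (metis abs_ge_zero power2_abs power_strict_mono pos2)+
    then show ?thesis by (simp add: q_def power_mult_distrib)
  qed
  have \<eta>0: "\<eta> n x = 0" if "\<bar>x - x0\<bar> \<le> r \<or> 2 * \<rho> \<le> \<bar>x - x0\<bar>" for n x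
    using q0[OF that] by (simp add: \<eta>_def)
  have den: "1 + real n * q x > 0" for n x using q_nonneg[of x] by (simp add: add_pos_nonneg)
  have \<eta>_bd: "0 \<le> \<eta> n x" "\<eta> n x \<le> 1" for n x
    using q_nonneg[of x] den[of n x] by (simp_all add: \<eta>_def field_simps)
  have T_bd: "0 \<le> T n t" "T n t \<le> 1" for n t
    by (auto simp: T_def intro!: power_le_one)
  have T0: "T n t0 = 1" for n by (simp add: T_def)
  have T_supp: "\<bar>t - t0\<bar> \<le> 1 / (real n + 1)" if "T n t \<noteq> 0" for n t
  proof (rule ccontr)
    assume "\<not> ?thesis"
    then have "1 \<le> (real n + 1) * \<bar>t - t0\<bar>" by (simp add: field_simps)
    then have "1\<^sup>2 \<le> ((real n + 1) * \<bar>t - t0\<bar>)\<^sup>2" by (intro power_mono) auto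
    then show False using that by (simp add: T_def power_mult_distrib)
  qed
  have C2_q: "C2_real q"
    unfolding q_def by (intro C2_real_intros C2_real_compose[OF C2_real_pos_part_cube])
  have C2_\<eta>: "C2_real (\<eta> n)" for n
    unfolding \<eta>_def using den[of n] by (intro C2_real_intros C2_q) (auto simp: less_imp_neq[symmetric])
  have C2_T: "C2_real (T n)" for n
    unfolding T_def by (intro C2_real_intros C2_real_compose[OF C2_real_pos_part_cube])
  note C2 = C2_real_intros A G C2_\<eta> C2_T C2_real_polynomial[OF p(1)]
  have C2_\<phi>: "C2_on Q (\<phi> n)" for n
  proof -
    \<comment> \<open>Expanding the product turns \<open>\<phi> n\<close> into four products of a
      function of \<open>t\<close> and a function of \<open>x\<close>.\<close>
    define a where "a = (\<lambda>i::nat. [\<lambda>t. 1, \<lambda>t. G t + D, T n, \<lambda>t. - (T n t * (G t + D))] ! i)"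
    define b where "b = (\<lambda>i::nat. [A, \<lambda>x. 1, \<lambda>x. \<eta> n x * (p n x - A x), \<eta> n] ! i)"
    have "C2_on Q (\<lambda>(t, x). \<Sum>i\<in>{..<4}. a i t * b i x)"
    proof (rule C2_on_tensor_sum)
      fix i :: nat assume "i \<in> {..<4}"
      then have "i = 0 \<or> i = 1 \<or> i = 2 \<or> i = 3" by auto
      then show "C2_real (a i)" "C2_real (b i)"
        by (elim disjE; simp add: a_def b_def; intro C2)+
    qed
    moreover have "(\<lambda>(t, x). \<Sum>i\<in>{..<4}. a i t * b i x) = \<phi> n"
      by (auto simp: fun_eq_iff \<phi>_def a_def b_def eval_nat_numeral algebra_simps)
    ultimately show ?thesis by simp
  qed
  have \<phi>_near: "\<phi> n (t, x) = A x + G t + D" if "\<bar>x - x0\<bar> \<le> r" for n t x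
    using \<eta>0[of x n] that by (simp add: \<phi>_def)
  have \<phi>0: "\<phi> n (t0, x0) = u (t0, x0)" for n
    using \<phi>_near[of x0 n t0] r by (simp add: D_def)
  \<comment> \<open>\<open>\<phi> n\<close> is a convex combination, with weight \<theta> on
    \<open>p n\<close>, of two majorants of \<open>u\<close>: \<open>A + G + D\<close> everywhere,
    and \<open>p n\<close> wherever \<theta> is nonzero.\<close>
  have above: "u (s, z) \<le> \<phi> n (s, z)" if s: "s > 0" for n s z
  proof -
    define \<theta> where "\<theta> = T n s * \<eta> n z"
    have \<theta>: "0 \<le> \<theta>" "\<theta> \<le> 1"
      using T_bd[of n s] \<eta>_bd[of n z] by (auto simp: \<theta>_def intro: mult_le_one)
    have 1: "u (s, z) \<le> A z + G s + D" using max[OF s, of z] by (simp add: D_def)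
    have 2: "\<theta> * u (s, z) \<le> \<theta> * p n z"
    proof (cases "\<theta> = 0")
      case False
      then have "T n s \<noteq> 0" "\<eta> n z \<noteq> 0" by (auto simp: \<theta>_def)
      then have "\<bar>s - t0\<bar> \<le> 1 / (real n + 1)" "\<bar>z - x0\<bar> \<le> 2 * \<rho>"
        using T_supp[of n s] \<eta>0[of z n] linear by blast+
      then show ?thesis using \<theta> p(2)[OF s] by (intro mult_left_mono) auto
    qed simp
    have "(1 - \<theta>) * u (s, z) \<le> (1 - \<theta>) * (A z + G s + D)"
      using 1 \<theta> by (intro mult_left_mono) auto
    with 2 have "u (s, z) \<le> (1 - \<theta>) * (A z + G s + D) + \<theta> * p n z" by (simp add: algebra_simps)
    also have "\<dots> = \<phi> n (s, z)" by (simp add: \<phi>_def \<theta>_def algebra_simps)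
    finally show ?thesis .
  qed
  have dt: "dt (\<phi> n) (t0, x0) = g" for n
  proof -
    have "(\<lambda>s. \<phi> n (s, x0)) = (\<lambda>s. A x0 + G s + D)" using \<phi>_near[of x0 n] r by auto
    then show ?thesis
      by (auto simp: dt_def intro!: DERIV_imp_deriv derivative_eq_intros g)
  qed
  have dx: "dx (\<phi> n) (t0, x0) = d" for n
  proof -
    have "\<forall>\<^sub>F y in nhds x0. y \<in> ball x0 r" using r by (intro eventually_nhds_in_open) auto
    then have ev: "\<forall>\<^sub>F y in nhds x0. \<phi> n (t0, y) = A y + G t0 + D"
      by eventually_elim (auto intro!: \<phi>_near simp: dist_real_def)
    have "((\<lambda>y. A y + G t0 + D) has_real_derivative d) (at x0)"
      by (auto intro!: derivative_eq_intros d)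
    then have "((\<lambda>y. \<phi> n (t0, y)) has_real_derivative d) (at x0)"
      using DERIV_cong_ev[OF refl ev refl] by blast
    then show ?thesis by (auto simp: dx_def intro!: DERIV_imp_deriv)
  qed
  define E where "E = {-\<rho><..<\<rho>}"
  define I where "I = {-r..r}"
  define M where "M = E - I"
  have sets: "E \<in> sets borel" "I \<in> sets borel" "M \<in> sets borel" by (auto simp: E_def I_def M_def)
  define w where "w z = u (t0, x0 + z) - u (t0, x0)" for z
  have meas_w: "w \<in> borel_measurable borel"
  proof -
    have "usc_on UNIV (\<lambda>z. u (t0, x0 + z))"
      by (rule usc_on_compose[OF usc]) (use t0 in \<open>auto simp: Q_def intro!: continuous_intros\<close>)
    from usc_on_borel_measurable[OF this] show ?thesis unfolding w_def by measurable
  qed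
  have w_bd: "\<bar>w z\<bar> \<le> 2 * B" for z
    using B(2)[of "(t0, x0 + z)"] B(2)[of "(t0, x0)"] t0 by (simp add: w_def Q_def)
  define f where "f n z = (\<phi> n (t0, x0 + z) - \<phi> n (t0, x0) - d * z) / z\<^sup>2" for n z
  define I2 where "I2 = (LINT z:(-E)|lborel. w z / z\<^sup>2)"
  \<comment> \<open>Every \<open>\<phi> n\<close> is admissible at the fixed radius \<rho> and has
    the same derivatives at the contact point; only the integral over \<open>E\<close> depends on
    \<open>n\<close>.\<close>
  have main: "g \<le> \<bar>d\<bar> * ((LINT z:E|lborel. f n z) + I2)" for n
  proof -
    have "\<forall>q\<in>Q. u q - \<phi> n q \<le> u (t0, x0) - \<phi> n (t0, x0)"
      using above \<phi>0 by (auto simp: Q_def)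
    moreover have "(t0, x0) \<in> Q" using t0 by (simp add: Q_def)
    ultimately have "dx (\<phi> n) (t0, x0) \<noteq> 0 \<longrightarrow> dt (\<phi> n) (t0, x0) \<le> H \<rho> (\<phi> n) u (t0, x0)"
      using u C2_\<phi> unfolding subsolution_def by blast
    then show ?thesis
      using d(2) unfolding dt dx H_def prod.case f_def I2_def E_def w_def by simp
  qed
  obtain CR where CR: "CR \<ge> 0" "\<And>z. \<bar>z\<bar> \<le> r \<Longrightarrow> \<bar>(A (x0 + z) - A x0 - d * z) / z\<^sup>2\<bar> \<le> CR"
    using C2_real_remainder_bound[OF A d(1)] by blast
  have contA: "continuous_on UNIV A" using C2_realE[OF A] by blast
  have cont\<phi>: "continuous_on UNIV (\<lambda>x. \<phi> n (t0, x))" for n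
  proof -
    have "C2_real (\<lambda>x. \<phi> n (t0, x))" unfolding \<phi>_def prod.case by (intro C2)
    then show ?thesis using C2_realE by blast
  qed
  have meas_f: "f n \<in> borel_measurable borel" for n
  proof -
    have "(\<lambda>z. \<phi> n (t0, x0 + z)) \<in> borel_measurable borel"
      by (intro borel_measurable_continuous_onI continuous_on_compose2[OF cont\<phi>] continuous_intros) auto
    then show ?thesis unfolding f_def by measurable
  qed
  have f_I: "f n z = (A (x0 + z) - A x0 - d * z) / z\<^sup>2" if "z \<in> I" for n z
    using \<phi>_near[of "x0 + z" n t0] \<phi>0[of n] that by (auto simp: f_def I_def D_def abs_le_iff)
  have M_bd: "r < \<bar>z\<bar>" "\<bar>z\<bar> < \<rho>" if "z \<in> M" for z using that by (auto simp: M_def E_def I_def)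
  obtain CA where CA: "\<And>x. x \<in> cball x0 \<rho> \<Longrightarrow> \<bar>A x\<bar> \<le> CA"
  proof -
    have "compact (A ` cball x0 \<rho>)"
      by (intro compact_continuous_image continuous_on_subset[OF contA]) auto
    then show thesis using that compact_imp_bounded by (force simp: bounded_iff)
  qed
  \<comment> \<open>A bound for \<open>f n\<close> on \<open>M\<close> that is uniform in
    \<open>n\<close>, for dominated convergence. The factor \<open>1 / r^2\<close> bounds the kernel
    on the annulus.\<close>
  define W where "W = (CA + \<bar>G t0 + D\<bar> + (B + 2) + B + \<bar>d\<bar> * \<rho>) / r\<^sup>2"
  have f_bd: "\<bar>f n z\<bar> \<le> W" if "z \<in> M" for n z
  proof -
    define \<theta> where "\<theta> = \<eta> n (x0 + z)"
    have \<theta>: "0 \<le> \<theta>" "\<theta> \<le> 1" using \<eta>_bd by (auto simp: \<theta>_def)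
    have "\<phi> n (t0, x0 + z) = (1 - \<theta>) * (A (x0 + z) + G t0 + D) + \<theta> * p n (x0 + z)"
      by (simp add: \<phi>_def \<theta>_def T0 algebra_simps)
    also have "\<bar>\<dots>\<bar> \<le> (1 - \<theta>) * \<bar>A (x0 + z) + G t0 + D\<bar> + \<theta> * \<bar>p n (x0 + z)\<bar>"
      using \<theta> by (intro order_trans[OF abs_triangle_ineq]) (simp add: abs_mult)
    also have "\<dots> \<le> 1 * (CA + \<bar>G t0 + D\<bar>) + 1 * (B + 2)"
    proof (intro add_mono mult_mono)
      show "\<bar>A (x0 + z) + G t0 + D\<bar> \<le> CA + \<bar>G t0 + D\<bar>"
        using CA[of "x0 + z"] M_bd[OF that] by (simp add: dist_real_def)
      show "\<bar>p n (x0 + z)\<bar> \<le> B + 2" using p(3)[of "x0 + z" n] M_bd[OF that] r by simp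
    qed (use \<theta> in auto)
    finally have 1: "\<bar>\<phi> n (t0, x0 + z)\<bar> \<le> CA + \<bar>G t0 + D\<bar> + (B + 2)" by simp
    have 2: "\<bar>\<phi> n (t0, x0)\<bar> \<le> B" using B(2)[of "(t0, x0)"] t0 by (simp add: \<phi>0 Q_def)
    have "\<bar>d * z\<bar> \<le> \<bar>d\<bar> * \<rho>"
      unfolding abs_mult using M_bd[OF that] by (intro mult_left_mono) auto
    with 1 2 have "\<bar>\<phi> n (t0, x0 + z) - \<phi> n (t0, x0) - d * z\<bar>
        \<le> CA + \<bar>G t0 + D\<bar> + (B + 2) + B + \<bar>d\<bar> * \<rho>" by linarith
    moreover have "r\<^sup>2 \<le> z\<^sup>2"
      using M_bd(1)[OF that] r by (intro abs_le_square_iff[THEN iffD1]) auto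
    moreover have "0 < r\<^sup>2" using r by simp
    ultimately show ?thesis
      unfolding f_def W_def abs_divide by (intro frac_le) auto
  qed
  have f_lim: "(\<lambda>n. f n z) \<longlonglongrightarrow> (w z - d * z) / z\<^sup>2" if "z \<in> M" for z
  proof -
    let ?x = "x0 + z"
    have qx: "q ?x > 0" using q_pos[of ?x] M_bd[OF that] r by simp
    have \<eta>_lim: "(\<lambda>n. \<eta> n ?x) \<longlonglongrightarrow> 1"
    proof -
      have "filterlim (\<lambda>n. 1 + q ?x * real n) at_top sequentially"
        by (intro filterlim_tendsto_add_at_top[OF tendsto_const]
            filterlim_tendsto_pos_mult_at_top[OF tendsto_const qx] filterlim_real_sequentially)
      then have "(\<lambda>n. 1 - inverse (1 + q ?x * real n)) \<longlonglongrightarrow> 1 - 0"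
        by (intro tendsto_diff tendsto_const tendsto_inverse_0_at_top)
      moreover have "1 - inverse (1 + q ?x * real n) = \<eta> n ?x" for n
        using den[of n ?x] by (simp add: \<eta>_def field_simps)
      ultimately show ?thesis by simp
    qed
    have "(\<lambda>n. A ?x + G t0 + D + 1 * \<eta> n ?x * (p n ?x - (A ?x + G t0 + D)))
      \<longlonglongrightarrow> A ?x + G t0 + D + 1 * 1 * (u (t0, ?x) - (A ?x + G t0 + D))"
      using M_bd[OF that] r by (intro tendsto_intros \<eta>_lim p(4)) auto
    then have "(\<lambda>n. \<phi> n (t0, ?x)) \<longlonglongrightarrow> u (t0, ?x)" by (simp add: \<phi>_def T0)
    then have "(\<lambda>n. (\<phi> n (t0, ?x) - u (t0, x0) - d * z) / z\<^sup>2)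
      \<longlonglongrightarrow> (u (t0, ?x) - u (t0, x0) - d * z) / z\<^sup>2"
      using M_bd(1)[OF that] r by (intro tendsto_intros) auto
    then show ?thesis by (simp add: f_def \<phi>0 w_def)
  qed
  have M_sub: "M \<subseteq> {-\<rho>..\<rho>}" by (auto simp: M_def E_def)
  have int_M: "set_integrable lborel M (f n)" for n
    by (rule set_integrable_bounded_real[OF meas_f sets(3) M_sub f_bd])
  have int_I: "set_integrable lborel I (f n)" for n
    by (rule set_integrable_bounded_real[OF meas_f sets(2), where a = r and C = CR])
      (use CR f_I in \<open>auto simp: I_def abs_le_iff\<close>)
  have split: "(LINT z:E|lborel. f n z) =
    (LINT z:I|lborel. (A (x0 + z) - A x0 - d * z) / z\<^sup>2) + (LINT z:M|lborel. f n z)" for n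
  proof -
    have "E = I \<union> M" using r by (auto simp: E_def I_def M_def)
    then have "(LINT z:E|lborel. f n z) = (LINT z:I|lborel. f n z) + (LINT z:M|lborel. f n z)"
      using set_integral_Un[of I M lborel "f n"] int_I int_M by (auto simp: M_def)
    moreover have "(LINT z:I|lborel. f n z) = (LINT z:I|lborel. (A (x0 + z) - A x0 - d * z) / z\<^sup>2)"
      using sets f_I by (intro set_lebesgue_integral_cong) auto
    ultimately show ?thesis by simp
  qed
  have lim_M: "(\<lambda>n. LINT z:M|lborel. f n z) \<longlonglongrightarrow> (LINT z:M|lborel. (w z - d * z) / z\<^sup>2)"
    unfolding set_lebesgue_integral_def
  proof (rule integral_dominated_convergence)
    show "integrable lborel (\<lambda>z. indicator M z *\<^sub>R W)"
      using set_integrable_bounded_real[of "\<lambda>z. W" M \<rho> "\<bar>W\<bar>"] sets M_sub by (simp add: set_integrable_def)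
    show "(\<lambda>z. indicator M z *\<^sub>R ((w z - d * z) / z\<^sup>2)) \<in> borel_measurable lborel"
      using meas_w sets by measurable
    show "(\<lambda>z. indicator M z *\<^sub>R f n z) \<in> borel_measurable lborel" for n
      using meas_f[of n] sets by measurable
    show "AE z in lborel. (\<lambda>n. indicator M z *\<^sub>R f n z) \<longlonglongrightarrow> indicator M z *\<^sub>R ((w z - d * z) / z\<^sup>2)"
      using f_lim by (auto simp: indicator_def)
    show "AE z in lborel. norm (indicator M z *\<^sub>R f n z) \<le> indicator M z *\<^sub>R W" for n
      using f_bd by (auto simp: indicator_def)
  qed
  have M_nl: "M \<subseteq> - {-r<..<r}" "- E \<subseteq> - {-r<..<r}" using r by (auto simp: M_def I_def E_def)
  have int_w: "set_integrable lborel M (\<lambda>z. w z / z\<^sup>2)" "set_integrable lborel (-E) (\<lambda>z. w z / z\<^sup>2)"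
    using set_integrable_nonlocal[OF meas_w r(1) M_nl(1) sets(3) w_bd]
      set_integrable_nonlocal[OF meas_w r(1) M_nl(2) _ w_bd] sets by auto
  have int_z: "set_integrable lborel M (\<lambda>z. d * (z / z\<^sup>2))"
  proof (intro set_integrable_mult_right set_integrable_bounded_real[OF _ sets(3) M_sub])
    show "\<bar>z / z\<^sup>2\<bar> \<le> 1 / r" if "z \<in> M" for z
      using M_bd(1)[OF that] r by (simp add: power2_eq_square abs_divide frac_le)
  qed simp
  have "(LINT z:M|lborel. z / z\<^sup>2) = 0"
    unfolding set_lebesgue_integral_def
    by (rule odd_integral_eq_0) (auto simp: indicator_def M_def E_def I_def)
  then have "(LINT z:M|lborel. d * (z / z\<^sup>2)) = 0" by (simp only: set_integral_mult_right mult_zero_right)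
  moreover have "(w z - d * z) / z\<^sup>2 = w z / z\<^sup>2 - d * (z / z\<^sup>2)" for z by (simp add: diff_divide_distrib)
  ultimately have "(LINT z:M|lborel. (w z - d * z) / z\<^sup>2) = (LINT z:M|lborel. w z / z\<^sup>2)"
    using set_integral_diff(2)[OF int_w(1) int_z] by simp
  moreover have "(LINT z:(-I)|lborel. w z / z\<^sup>2) = (LINT z:M|lborel. w z / z\<^sup>2) + I2"
  proof -
    have "- I = M \<union> - E" "M \<inter> - E = {}" using r by (auto simp: M_def E_def I_def)
    then show ?thesis using set_integral_Un[OF _ int_w] by (simp add: I2_def)
  qed
  ultimately have lim: "(\<lambda>n. \<bar>d\<bar> * ((LINT z:E|lborel. f n z) + I2)) \<longlonglongrightarrow>
    \<bar>d\<bar> * ((LINT z:I|lborel. (A (x0 + z) - A x0 - d * z) / z\<^sup>2) + (LINT z:(-I)|lborel. w z / z\<^sup>2))"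
    unfolding split using lim_M by (auto intro!: tendsto_eq_intros simp: algebra_simps)
  show ?thesis
    using LIMSEQ_le_const[OF lim] main unfolding I_def w_def by blast
qed

subsection \<open>Doubling of variables\<close>

definition dbl :: "real \<Rightarrow> real \<Rightarrow> (real \<times> real \<Rightarrow> real) \<Rightarrow> (real \<times> real \<Rightarrow> real) \<Rightarrow>
    real \<Rightarrow> real \<Rightarrow> real \<Rightarrow> real \<Rightarrow> real" where
  "dbl N l u w t x s y = u (t, x) + w (s, y) - N * (x - y) ^ 4 - N * (t - s)\<^sup>2 - l * (t + s)"

text \<open>The symmetry lets estimates be proved for the first pair of variables and then applied
  to \<open>w\<close> with the roles exchanged.\<close>

lemma dbl_swap: "dbl N l u w t x s y = dbl N l w u s y t x"
proof -
  have "(x - y) ^ 4 = (y - x) ^ 4" using power2_commute[of x y] by (simp add: power4_eq_xxxx power2_eq_square)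
  then show ?thesis by (simp add: dbl_def power2_commute[of t s])
qed

text \<open>The second pair of variables is frozen at a near-maximizer. The extra penalty on \<open>x\<close> is centred
  at \<open>y1\<close>, not at \<open>x1\<close>, so that the test function remains exactly quartic.\<close>

lemma dbl_frozen:
  assumes u: "subsolution \<rho> u" and \<rho>: "\<rho> > 0" and N: "N > 0"
  obtains K where "K \<ge> 0"
    "\<And>w l \<eta> \<tau> T t1 x1 s1 y1. 0 < \<eta> \<Longrightarrow> \<eta> \<le> 1 \<Longrightarrow> 0 < \<tau> \<Longrightarrow> 0 < t1 \<Longrightarrow> \<bar>x1 - y1\<bar> \<le> \<eta> \<Longrightarrow>
      (\<And>t x. 0 < t \<Longrightarrow> dbl N l u w t x s1 y1 \<le> dbl N l u w t1 x1 s1 y1 + \<eta> ^ 4) \<Longrightarrow>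
      (\<And>t x. 0 < t \<Longrightarrow> dbl N l u w t1 x1 s1 y1 - \<eta> ^ 4 \<le> dbl N l u w t x s1 y1 \<Longrightarrow>
        \<tau> \<le> t \<and> t \<le> T \<and> \<bar>x - y1\<bar> \<le> 1) \<Longrightarrow>
      2 * N * (t1 - s1) + l \<le> K * \<eta>"
proof -
  obtain K0 where K0: "K0 \<ge> 0"
    "\<And>y a b t x. t > 0 \<Longrightarrow> \<bar>x - y\<bar> \<le> 1 \<Longrightarrow>
      (\<And>s z. s > 0 \<Longrightarrow> u (s, z) - ((N + 1) * (z - y) ^ 4 + (a * s\<^sup>2 + b * s))
         \<le> u (t, x) - ((N + 1) * (x - y) ^ 4 + (a * t\<^sup>2 + b * t))) \<Longrightarrow>
      2 * a * t + b \<le> K0 * \<bar>x - y\<bar> ^ 3"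
    using subsolution_quartic_test[OF u \<rho>, of "N + 1"] N by auto
  \<comment> \<open>\<open>8 * K0\<close> comes from \<open>(2 * \<eta>)^3 \<le> 8 * \<eta>\<close>,
    and \<open>4 * N + 4\<close> from replacing the time \<open>t\<close> of the maximum by
    \<open>t1\<close>, at distance at most \<open>2 * \<eta>\<close>.\<close>
  define K where "K = 8 * K0 + 4 * N + 4"
  have "K \<ge> 0" using K0 N by (simp add: K_def)
  moreover have "2 * N * (t1 - s1) + l \<le> K * \<eta>"
    if \<eta>: "0 < \<eta>" "\<eta> \<le> 1" and \<tau>: "0 < \<tau>" and t1: "0 < t1" and xy: "\<bar>x1 - y1\<bar> \<le> \<eta>"
      and sup: "\<And>t x. 0 < t \<Longrightarrow> dbl N l u w t x s1 y1 \<le> dbl N l u w t1 x1 s1 y1 + \<eta> ^ 4"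
      and loc: "\<And>t x. 0 < t \<Longrightarrow> dbl N l u w t1 x1 s1 y1 - \<eta> ^ 4 \<le> dbl N l u w t x s1 y1 \<Longrightarrow>
        \<tau> \<le> t \<and> t \<le> T \<and> \<bar>x - y1\<bar> \<le> 1"
    for w l \<eta> \<tau> T t1 x1 s1 y1
  proof -
    define f where "f = (\<lambda>p. u p + - ((N + 1) * (snd p - y1) ^ 4 + N * (fst p - s1)\<^sup>2
      + (fst p - t1)\<^sup>2 + l * fst p))"
    define L where "L = {\<tau>..T} \<times> {y1 - 1..y1 + 1}"
    have f_dbl: "dbl N l u w t x s1 y1 = f (t, x) + w (s1, y1) - l * s1 + (x - y1) ^ 4 + (t - t1)\<^sup>2" for t x
      by (simp add: f_def dbl_def algebra_simps)
    have xy4: "(x1 - y1) ^ 4 \<le> \<eta> ^ 4"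
      using power_mono[OF xy, of 4] by simp
    have "usc_on Q u" using u by (simp add: subsolution_def)
    moreover have "usc_on Q (\<lambda>p. - ((N + 1) * (snd p - y1) ^ 4 + N * (fst p - s1)\<^sup>2
      + (fst p - t1)\<^sup>2 + l * fst p))"
      by (intro continuous_on_imp_usc_on continuous_intros)
    ultimately have "usc_on Q f" unfolding f_def by (rule usc_on_add)
    moreover have "compact L" "L \<subseteq> Q" "(t1, x1) \<in> Q"
      using \<tau> t1 by (auto simp: L_def Q_def intro!: compact_Times)
    moreover have "p \<in> L" if "p \<in> Q" "f (t1, x1) \<le> f p" for p
    proof -
      obtain t x where p: "p = (t, x)" by force
      have "0 \<le> (x - y1) ^ 4" "0 \<le> (t - t1)\<^sup>2" by simp_all
      then have "dbl N l u w t1 x1 s1 y1 - \<eta> ^ 4 \<le> dbl N l u w t x s1 y1"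
        using that(2) xy4 unfolding f_dbl p by (simp only: diff_self power_zero_numeral)
      then show ?thesis using loc[of t x] that(1) by (auto simp: p L_def Q_def)
    qed
    ultimately obtain p where p: "p \<in> L" "f (t1, x1) \<le> f p" "\<forall>q\<in>Q. f q \<le> f p"
      using usc_on_attains_sup_superlevel[of L Q f "(t1, x1)"] by blast
    obtain t x where tx: "p = (t, x)" by force
    have t: "0 < t" and x: "\<bar>x - y1\<bar> \<le> 1" using p(1) \<tau> by (auto simp: tx L_def)
    \<comment> \<open>At \<open>(t1, x1)\<close> the added terms amount to at most
      \<open>\<eta> ^ 4\<close>, and moving to the maximum gains at most another
      \<open>\<eta> ^ 4\<close> in \<open>dbl\<close>. The added terms at the maximum cannot exceed
      the total.\<close>
    have sum: "(x - y1) ^ 4 + (t - t1)\<^sup>2 \<le> 2 * \<eta> ^ 4"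
      using sup[OF t, of x] p(2) xy4 unfolding f_dbl tx by simp
    have \<eta>4: "\<eta> ^ 4 \<le> \<eta>\<^sup>2" using \<eta> by (intro power_decreasing) auto
    have nonneg: "0 \<le> (x - y1) ^ 4" "0 \<le> (t - t1)\<^sup>2" "0 \<le> \<eta>\<^sup>2" "0 \<le> \<eta> ^ 4" by simp_all
    have "(t - t1)\<^sup>2 \<le> 4 * \<eta>\<^sup>2" using sum \<eta>4 nonneg by linarith
    then have "(t - t1)\<^sup>2 \<le> (2 * \<eta>)\<^sup>2" by (simp add: power_mult_distrib)
    then have t_near: "\<bar>t - t1\<bar> \<le> 2 * \<eta>"
      using \<eta>(1) unfolding abs_le_square_iff[symmetric] by simp
    have "(x - y1) ^ 4 \<le> 16 * \<eta> ^ 4" using sum nonneg by linarith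
    then have "\<bar>x - y1\<bar> ^ 4 \<le> (2 * \<eta>) ^ 4" by (simp add: power_mult_distrib)
    then have x_near: "\<bar>x - y1\<bar> \<le> 2 * \<eta>"
      using \<eta>(1) by (subst (asm) power_mono_iff) auto
    \<comment> \<open>The time profile is \<open>N * (t - s1)^2 + (t - t1)^2 + l * t\<close> with
      its coefficients collected, up to a constant.\<close>
    have "2 * (N + 1) * t + (l - 2 * N * s1 - 2 * t1) \<le> K0 * \<bar>x - y1\<bar> ^ 3"
    proof (rule K0(2)[OF t x])
      fix s z :: real assume s: "s > 0"
      have "f (s, z) \<le> f (t, x)" using p(3) s by (auto simp: tx Q_def)
      then show "u (s, z) - ((N + 1) * (z - y1) ^ 4 + ((N + 1) * s\<^sup>2 + (l - 2 * N * s1 - 2 * t1) * s))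
        \<le> u (t, x) - ((N + 1) * (x - y1) ^ 4 + ((N + 1) * t\<^sup>2 + (l - 2 * N * s1 - 2 * t1) * t))"
        by (simp add: f_def power2_eq_square algebra_simps)
    qed
    also have "\<dots> \<le> K0 * (8 * \<eta>)"
    proof (intro mult_left_mono K0(1))
      have "\<bar>x - y1\<bar> ^ 3 \<le> (2 * \<eta>) ^ 3" using x_near by (intro power_mono) auto
      also have "\<dots> = 8 * \<eta> ^ 3" by (simp add: power_mult_distrib)
      also have "\<dots> \<le> 8 * \<eta> ^ 1" using \<eta> by (intro mult_left_mono power_decreasing) auto
      finally show "\<bar>x - y1\<bar> ^ 3 \<le> 8 * \<eta>" by simp
    qed
    finally have 1: "2 * (N + 1) * t + (l - 2 * N * s1 - 2 * t1) \<le> K0 * (8 * \<eta>)" .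
    have "(2 * N + 2) * (t1 - t) \<le> (2 * N + 2) * (2 * \<eta>)"
      using t_near N by (intro mult_left_mono) auto
    with 1 show ?thesis by (simp add: K_def algebra_simps)
  qed
  ultimately show thesis by (rule that)
qed

section \<open>A bounded localizing function\<close>

text \<open>Being bounded with bounded derivatives, it can be added with a factor
  \<open>2 * \<delta>\<close> at a cost of order \<delta> in the functional, in its gradient and, at
  fixed radius, in the nonlocal terms. It is 1 at 0 and falls to 1/2 at distance 1, which is enough
  to confine a maximum.\<close>

definition bump :: "real \<Rightarrow> real" where "bump y = inverse (1 + y\<^sup>2)"

definition bump' :: "real \<Rightarrow> real" where "bump' y = - 2 * y * inverse (1 + y\<^sup>2) * inverse (1 + y\<^sup>2)"

lemma bump_den: "1 + y\<^sup>2 > (0::real)" "1 + y\<^sup>2 \<noteq> (0::real)"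
  by (simp_all add: add_pos_nonneg add_nonneg_eq_0_iff)

lemma bump_bounds: "0 < bump y" "bump y \<le> 1"
  using bump_den[of y] by (simp_all add: bump_def inverse_le_1_iff)

lemma has_real_derivative_bump: "(bump has_real_derivative bump' y) (at y)"
  unfolding bump_def[abs_def] bump'_def
  by (auto intro!: derivative_eq_intros simp: bump_den)

lemma C2_real_bump: "C2_real bump"
  unfolding bump_def[abs_def] using bump_den by (intro C2_real_intros) auto

lemma abs_bump'_le: "\<bar>bump' y\<bar> \<le> 1"
proof -
  have "\<bar>2 * y\<bar> \<le> 1 + y\<^sup>2"
    using sum_squares_bound[of 1 "\<bar>y\<bar>"] by (simp add: abs_mult)
  then have "\<bar>2 * y\<bar> * inverse (1 + y\<^sup>2) \<le> 1"
    using bump_den[of y] by (simp add: field_simps)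
  moreover have "inverse (1 + y\<^sup>2) \<le> 1" "0 < inverse (1 + y\<^sup>2)"
    using bump_bounds[of y] by (simp_all add: bump_def)
  ultimately have "\<bar>2 * y\<bar> * inverse (1 + y\<^sup>2) * inverse (1 + y\<^sup>2) \<le> 1 * 1"
    by (intro mult_mono) auto
  then show ?thesis using bump_den[of y] by (simp add: bump'_def abs_mult)
qed

text \<open>\<open>?h\<close> is the second derivative. Its numerator satisfies
  \<open>|6 * y^2 - 2| \<le> 6 * (1 + y^2)\<close>, which one of the three inverse factors
  absorbs.\<close>

lemma bump_remainder_le: "\<bar>bump (y + z) - bump y - bump' y * z\<bar> \<le> 6 * z\<^sup>2"
proof (rule C2_real_remainder_le[OF has_real_derivative_bump])
  let ?h = "\<lambda>y::real. (6 * y\<^sup>2 - 2) * inverse (1 + y\<^sup>2) * inverse (1 + y\<^sup>2) * inverse (1 + y\<^sup>2)"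
  show "(bump' has_real_derivative ?h y) (at y)" for y
  proof -
    define i where "i = inverse (1 + y\<^sup>2)"
    have i: "i * (1 + y\<^sup>2) = 1" using bump_den(2)[of y] by (simp add: i_def)
    have "(bump' has_real_derivative - 2 * i * i + 8 * y\<^sup>2 * i * i * i) (at y)"
      unfolding bump'_def[abs_def]
      by (rule derivative_eq_intros refl bump_den(2))+
        (unfold i_def[symmetric], simp add: power2_eq_square algebra_simps)
    also have "- 2 * i * i + 8 * y\<^sup>2 * i * i * i = (6 * y\<^sup>2 - 2) * i * i * i" using i by algebra
    finally show ?thesis by (simp add: i_def)
  qed
  show "\<bar>?h y\<bar> \<le> 6" for y
  proof -
    define i where "i = inverse (1 + y\<^sup>2)"
    have i: "0 \<le> i" "i \<le> 1" using bump_bounds[of y] by (simp_all add: i_def bump_def)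
    have "\<bar>6 * y\<^sup>2 - 2\<bar> \<le> 6 * (1 + y\<^sup>2)" by (auto simp: abs_le_iff)
    then have "\<bar>6 * y\<^sup>2 - 2\<bar> * i \<le> 6 * (1 + y\<^sup>2) * i" using i by (intro mult_right_mono) auto
    also have "\<dots> = 6"
      unfolding i_def mult.assoc right_inverse[OF bump_den(2)] by simp
    finally have "\<bar>6 * y\<^sup>2 - 2\<bar> * i * i * i \<le> 6 * 1 * 1"
      using i by (intro mult_mono) auto
    then show ?thesis using i by (simp add: abs_mult flip: i_def)
  qed
qed

text \<open>The case of a nonzero gradient: both singular integrals are \<open>O(r)\<close>, and the maximum condition
  compares the nonlocal parts up to \<open>\<delta>\<close>.\<close>

lemma dbl_maximum_inequality:
  fixes N l \<delta> \<eta> \<tau> r :: real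
  assumes u: "subsolution \<rho> u" and w: "subsolution \<rho> w" and r: "0 < r" "r < \<rho>"
    and B: "B \<ge> 0" "\<And>p. p \<in> Q \<Longrightarrow> \<bar>u p\<bar> \<le> B" "\<And>p. p \<in> Q \<Longrightarrow> \<bar>w p\<bar> \<le> B"
    and N: "N > 0" and l: "l \<ge> 0" and \<delta>: "0 \<le> \<delta>" "\<delta> \<le> 1" "\<delta> \<le> N * \<eta> ^ 3"
    and \<eta>: "0 < \<eta>" and xy: "\<eta> \<le> \<bar>x - y\<bar>" "\<bar>x - y\<bar> \<le> 1"
    and ts: "0 < t" "0 < s" "\<bar>t - s\<bar> \<le> \<tau>"
    and max: "\<And>t' x' s' y'. 0 < t' \<Longrightarrow> 0 < s' \<Longrightarrow> dbl N l u w t' x' s' y' + 2 * \<delta> * bump (x' - x1)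
      \<le> dbl N l u w t x s y + 2 * \<delta> * bump (x - x1)"
  defines "C \<equiv> N * (6 + 4 * \<rho> + \<rho>\<^sup>2)" and "J \<equiv> (LINT z:(- {-r<..<r})|lborel. 1 / z\<^sup>2)"
  shows "2 * l \<le> 4 * N * (2 * r * (2 * C + 12) + 2 * \<delta> * J)
    + 2 * \<delta> * (2 * r * (C + 12) + 2 * B * J + \<tau> / \<eta> ^ 3)"
proof -
  \<comment> \<open>\<open>e\<close> is the gradient of the unperturbed penalty. Only the variable
    \<open>x\<close> is localized, so the equation for \<open>u\<close> sees \<open>du\<close>,
    while that for \<open>w\<close> sees \<open>dw = - e\<close>.\<close>
  define e where "e = 4 * N * (x - y) ^ 3"
  define du where "du = e - 2 * \<delta> * bump' (x - x1)"
  define dw where "dw = 4 * N * (y - x) ^ 3"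
  define A where "A z = N * (z - y) ^ 4 - 2 * \<delta> * bump (z - x1)" for z
  define A2 where "A2 z = N * (z - x) ^ 4" for z
  define I1 where "I1 = (LINT z:{-r..r}|lborel. (A (x + z) - A x - du * z) / z\<^sup>2)"
  define I2 where "I2 = (LINT z:{-r..r}|lborel. (A2 (y + z) - A2 y - dw * z) / z\<^sup>2)"
  define fu where "fu z = u (t, x + z) - u (t, x)" for z
  define fw where "fw z = w (s, y + z) - w (s, y)" for z
  define J1 where "J1 = (LINT z:(- {-r..r})|lborel. fu z / z\<^sup>2)"
  define J2 where "J2 = (LINT z:(- {-r..r})|lborel. fw z / z\<^sup>2)"
  have C: "C \<ge> 0" using N r by (simp add: C_def)
  have J: "J \<ge> 0" unfolding J_def set_lebesgue_integral_def by (intro integral_nonneg_AE) auto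
  have abs_e: "\<bar>e\<bar> = 4 * N * \<bar>x - y\<bar> ^ 3" "\<bar>dw\<bar> = 4 * N * \<bar>x - y\<bar> ^ 3"
    using N by (simp_all add: e_def dw_def abs_mult power_abs abs_minus_commute)
  have "\<eta> ^ 3 \<le> \<bar>x - y\<bar> ^ 3" using \<eta> xy by (intro power_mono) auto
  then have "N * \<eta> ^ 3 \<le> N * \<bar>x - y\<bar> ^ 3" using N by (intro mult_left_mono) auto
  then have e_ge: "4 * (N * \<eta> ^ 3) \<le> \<bar>e\<bar>" unfolding abs_e by linarith
  have N\<eta>: "0 < N * \<eta> ^ 3" using N \<eta> by simp
  have "\<bar>2 * \<delta> * bump' (x - x1)\<bar> \<le> 2 * \<delta> * 1"
    unfolding abs_mult using \<delta> abs_bump'_le by (intro mult_mono) auto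
  then have due: "\<bar>\<bar>du\<bar> - \<bar>e\<bar>\<bar> \<le> 2 * \<delta>" unfolding du_def by linarith
  \<comment> \<open>The perturbation is at most \<open>2 * \<delta> \<le> 2 * N * \<eta>^3\<close>,
    which leaves at least half of the lower bound for \<open>|e|\<close>.\<close>
  then have du_ge: "2 * (N * \<eta> ^ 3) \<le> \<bar>du\<bar>" using e_ge \<delta>(3) by linarith
  have e_le: "\<bar>e\<bar> \<le> 4 * N"
    unfolding abs_e using N xy power_le_one[of "\<bar>x - y\<bar>" 3] by simp
  have dA: "(A has_real_derivative du) (at x)"
    unfolding A_def[abs_def] du_def e_def
    by (auto intro!: derivative_eq_intros DERIV_chain2[OF has_real_derivative_bump] simp: algebra_simps)
  have dA2: "(A2 has_real_derivative dw) (at y)"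
    unfolding A2_def[abs_def] dw_def by (auto intro!: derivative_eq_intros)
  have u_ineq: "2 * N * (t - s) + l \<le> \<bar>du\<bar> * (I1 + J1)"
    unfolding I1_def J1_def fu_def
  proof (rule subsolution_small_radius[OF u r _ _ dA])
    show "C2_real A"
      unfolding A_def[abs_def] by (intro C2_real_intros C2_real_compose[OF C2_real_bump])
    show "C2_real (\<lambda>t'. N * (t' - s)\<^sup>2 + l * t')" by (intro C2_real_intros)
    show "((\<lambda>t'. N * (t' - s)\<^sup>2 + l * t') has_real_derivative 2 * N * (t - s) + l) (at t)"
      by (auto intro!: derivative_eq_intros)
    show "du \<noteq> 0" using du_ge N\<eta> by auto
    show "u (t', x') - (A x' + (N * (t' - s)\<^sup>2 + l * t')) \<le> u (t, x) - (A x + (N * (t - s)\<^sup>2 + l * t))"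
      if "t' > 0" for t' x'
      using max[OF that ts(2), of x' y] by (simp add: A_def dbl_def algebra_simps)
  qed (rule ts)
  have w_ineq: "2 * N * (s - t) + l \<le> \<bar>e\<bar> * (I2 + J2)"
    unfolding abs_e(1) abs_e(2)[symmetric] I2_def J2_def fw_def
  proof (rule subsolution_small_radius[OF w r _ _ dA2])
    show "C2_real A2" unfolding A2_def[abs_def] by (intro C2_real_intros)
    show "C2_real (\<lambda>s'. N * (s' - t)\<^sup>2 + l * s')" by (intro C2_real_intros)
    show "((\<lambda>s'. N * (s' - t)\<^sup>2 + l * s') has_real_derivative 2 * N * (s - t) + l) (at s)"
      by (auto intro!: derivative_eq_intros)
    have "\<bar>dw\<bar> > 0" using e_ge N\<eta> unfolding abs_e by linarith
    then show "dw \<noteq> 0" by simp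
    show "w (s', y') - (A2 y' + (N * (s' - t)\<^sup>2 + l * s')) \<le> w (s, y) - (A2 y + (N * (s - t)\<^sup>2 + l * s))"
      if "s' > 0" for s' y'
    proof -
      have "dbl N l w u s' y' t x \<le> dbl N l w u s y t x"
        using max[OF ts(1) that, of x y'] by (simp add: dbl_swap[of N l u w])
      then show ?thesis by (simp add: A2_def dbl_def algebra_simps)
    qed
  qed (rule ts)
  have quart: "(N * (d + z) ^ 4 - N * d ^ 4 - 4 * N * d ^ 3 * z) / z\<^sup>2 \<le> C"
    if "\<bar>z\<bar> \<le> r" "\<bar>d\<bar> \<le> 1" for d z
    unfolding C_def using quartic_remainder_le[of N d z \<rho>] N r that by simp
  have "I1 \<le> (r - - r) * (C + 12)"
    unfolding I1_def
  proof (rule set_integral_le_const)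
    fix z assume "z \<in> {-r..r}"
    then have z: "\<bar>z\<bar> \<le> r" by auto
    let ?b = "bump (x - x1 + z) - bump (x - x1) - bump' (x - x1) * z"
    have "\<bar>?b / z\<^sup>2\<bar> \<le> 6"
      using bump_remainder_le[of "x - x1" z] by (cases "z = 0") (auto simp: abs_divide field_simps)
    then have "- (?b / z\<^sup>2) \<le> 6" by linarith
    then have "2 * \<delta> * - (?b / z\<^sup>2) \<le> 2 * \<delta> * 6" using \<delta> by (intro mult_left_mono) auto
    then have "2 * \<delta> * - (?b / z\<^sup>2) \<le> 12" using \<delta>(2) by linarith
    moreover have "(A (x + z) - A x - du * z) / z\<^sup>2
      = (N * ((x - y) + z) ^ 4 - N * (x - y) ^ 4 - 4 * N * (x - y) ^ 3 * z) / z\<^sup>2 + 2 * \<delta> * - (?b / z\<^sup>2)"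
      unfolding A_def du_def e_def by (simp add: algebra_simps add_divide_distrib diff_divide_distrib)
    ultimately show "(A (x + z) - A x - du * z) / z\<^sup>2 \<le> C + 12"
      using quart[OF z xy(2)] by linarith
  qed (use r C in auto)
  then have I1: "I1 \<le> 2 * r * (C + 12)" by simp
  have "I2 \<le> (r - - r) * C"
    unfolding I2_def
  proof (rule set_integral_le_const)
    fix z assume "z \<in> {-r..r}"
    then have z: "\<bar>z\<bar> \<le> r" by auto
    show "(A2 (y + z) - A2 y - dw * z) / z\<^sup>2 \<le> C"
      using quart[OF z, of "y - x"] xy(2) by (simp add: A2_def dw_def abs_minus_commute algebra_simps)
  qed (use r C in auto)
  then have I2: "I2 \<le> 2 * r * C" by simp
  have sub: "- {-r..r} \<subseteq> - {-r<..<r}" by auto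
  have Jset: "- {-r..r} \<in> sets borel" by simp
  have fu_bd: "\<bar>fu z\<bar> \<le> 2 * B" for z
    using B(2)[of "(t, x + z)"] B(2)[of "(t, x)"] ts by (simp add: fu_def Q_def)
  have fw_bd: "\<bar>fw z\<bar> \<le> 2 * B" for z
    using B(3)[of "(s, y + z)"] B(3)[of "(s, y)"] ts by (simp add: fw_def Q_def)
  have meas: "(\<lambda>z. v (a, b + z) - v (a, b)) \<in> borel_measurable borel" if "subsolution \<rho> v" "0 < a" for v a b
  proof -
    have "usc_on UNIV (\<lambda>z. v (a, b + z))"
      by (rule usc_on_compose[of Q v]) (use that in \<open>auto simp: subsolution_def Q_def intro!: continuous_intros\<close>)
    from usc_on_borel_measurable[OF this] show ?thesis by measurable
  qed
  have "J1 \<le> 2 * B * J"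
    unfolding J1_def J_def
    using fu_bd B(1) by (intro nonlocal_le[OF r(1) sub]) (auto simp: abs_le_iff)
  have int: "set_integrable lborel (- {-r..r}) (\<lambda>z. fu z / z\<^sup>2)" "set_integrable lborel (- {-r..r}) (\<lambda>z. fw z / z\<^sup>2)"
    using set_integrable_nonlocal[OF meas[OF u ts(1), of x] r(1) sub Jset, of "2 * B"] fu_bd
      set_integrable_nonlocal[OF meas[OF w ts(2), of y] r(1) sub Jset, of "2 * B"] fw_bd
    unfolding fu_def fw_def by blast+
  have "J1 + J2 = (LINT z:(- {-r..r})|lborel. (fu z + fw z) / z\<^sup>2)"
    using set_integral_add(2)[OF int] by (simp add: J1_def J2_def add_divide_distrib)
  also have "\<dots> \<le> 2 * \<delta> * J"
    unfolding J_def
  proof (rule nonlocal_le[OF r(1) sub])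
    fix z
    \<comment> \<open>Shifting \<open>x\<close> and \<open>y\<close> by the same \<open>z\<close>
      leaves the penalty unchanged, so only the bump enters the comparison.\<close>
    have "fu z + fw z \<le> 2 * \<delta> * (bump (x - x1) - bump (x + z - x1))"
      using max[OF ts(1,2), of "x + z" "y + z"] by (simp add: fu_def fw_def dbl_def algebra_simps)
    also have "\<dots> \<le> 2 * \<delta> * 1"
      using bump_bounds(2)[of "x - x1"] bump_bounds(1)[of "x + z - x1"] \<delta>(1) by (intro mult_left_mono) auto
    finally show "fu z + fw z \<le> 2 * \<delta>" by simp
  qed (use \<delta> in auto)
  finally have J12: "J1 + J2 \<le> 2 * \<delta> * J" .
  \<comment> \<open>Replacing \<open>|du|\<close> by \<open>|e|\<close> leaves the error
    \<open>(|du| - |e|) * X\<close>, whose first factor is at most \<open>2 * \<delta>\<close> in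
    absolute value. Hence the two-sided bound on \<open>X\<close> by \<open>R\<close>.\<close>
  define X where "X = I1 + J1"
  define R where "R = 2 * r * (C + 12) + 2 * B * J + \<tau> / \<eta> ^ 3"
  have \<tau>: "0 \<le> \<tau> / \<eta> ^ 3" using ts(3) \<eta> by (intro divide_nonneg_nonneg) auto
  have X_le: "X \<le> R" unfolding X_def R_def using I1 \<open>J1 \<le> 2 * B * J\<close> \<tau> by linarith
  have X_ge: "- R \<le> X"
  proof (cases "X \<ge> 0")
    case True
    have "0 \<le> R" using C J B(1) r \<tau> by (simp add: R_def)
    with True show ?thesis by simp
  next
    case False
    \<comment> \<open>The inequality for \<open>u\<close> itself limits a negative \<open>X\<close>:
      it gives \<open>|du| * X \<ge> - 2 * N * \<tau>\<close>, and
      \<open>|du| \<ge> 2 * N * \<eta>^3\<close>. This is the origin of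
      \<open>\<tau> / \<eta> ^ 3\<close> in \<open>R\<close>.\<close>
    have "2 * (N * \<eta> ^ 3) * (- X) \<le> \<bar>du\<bar> * (- X)" using du_ge False by (intro mult_right_mono) auto
    also have "\<dots> \<le> 2 * N * (s - t)" using u_ineq l by (simp add: X_def algebra_simps)
    also have "\<dots> \<le> 2 * N * \<tau>" using ts(3) N by (intro mult_left_mono) auto
    finally have "(2 * N) * (\<eta> ^ 3 * (- X)) \<le> (2 * N) * \<tau>" by (simp only: mult.assoc)
    then have "\<eta> ^ 3 * (- X) \<le> \<tau>" using N by (subst (asm) mult_le_cancel_left_pos) auto
    then have "- X \<le> \<tau> / \<eta> ^ 3" using \<eta> by (subst pos_le_divide_eq) (simp_all add: mult.commute)
    moreover have "0 \<le> 2 * r * (C + 12)" "0 \<le> 2 * B * J" using C J B(1) r by simp_all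
    ultimately show ?thesis by (simp add: R_def)
  qed
  have "2 * l \<le> \<bar>du\<bar> * X + \<bar>e\<bar> * (I2 + J2)" using u_ineq w_ineq by (simp add: X_def algebra_simps)
  also have "\<dots> = \<bar>e\<bar> * (X + I2 + J2) + (\<bar>du\<bar> - \<bar>e\<bar>) * X" by (simp add: algebra_simps)
  also have "(\<bar>du\<bar> - \<bar>e\<bar>) * X \<le> 2 * \<delta> * R"
  proof -
    have "(\<bar>du\<bar> - \<bar>e\<bar>) * X \<le> \<bar>\<bar>du\<bar> - \<bar>e\<bar>\<bar> * \<bar>X\<bar>" by (metis abs_ge_self abs_mult)
    also have "\<dots> \<le> 2 * \<delta> * R" using due X_le X_ge \<delta> by (intro mult_mono) auto
    finally show ?thesis .
  qed
  also have "\<bar>e\<bar> * (X + I2 + J2) \<le> \<bar>e\<bar> * (2 * r * (2 * C + 12) + 2 * \<delta> * J)"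
    using I1 I2 J12 by (intro mult_left_mono) (simp_all add: X_def algebra_simps)
  also have "\<dots> \<le> 4 * N * (2 * r * (2 * C + 12) + 2 * \<delta> * J)"
    using e_le C J r \<delta> by (intro mult_right_mono) auto
  finally show ?thesis by (simp add: R_def)
qed

section \<open>Contradiction from a positive value of the sum\<close>

text \<open>The initial conditions are eventual bounds, the form in which they make the extension of
  each subsolution to time 0 upper semicontinuous.\<close>

lemma subsolution_pair_nonpos:
  assumes \<rho>: "\<rho> > 0" and u: "subsolution \<rho> u" and w: "subsolution \<rho> w"
    and u0: "bounded (range u0)" "uniformly_continuous_on UNIV u0"
    and init_u: "\<And>x a. u0 x < a \<Longrightarrow> \<forall>\<^sub>F p in at (0, x) within Q. u p < a"
    and init_w: "\<And>x a. - u0 x < a \<Longrightarrow> \<forall>\<^sub>F p in at (0, x) within Q. w p < a"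
    and t0: "t0 > 0"
  shows "u (t0, x0) + w (t0, x0) \<le> 0"
proof (rule ccontr)
  define m where "m = u (t0, x0) + w (t0, x0)"
  assume "\<not> ?thesis"
  then have m: "m > 0" by (simp add: m_def)
  obtain Bu where Bu: "Bu \<ge> 0" "\<And>p. p \<in> Q \<Longrightarrow> \<bar>u p\<bar> \<le> Bu"
    using subsolution_bounded[OF u] by blast
  obtain Bw where Bw: "Bw \<ge> 0" "\<And>p. p \<in> Q \<Longrightarrow> \<bar>w p\<bar> \<le> Bw"
    using subsolution_bounded[OF w] by blast
  define B where "B = Bu + Bw"
  have B: "B \<ge> 0" "\<And>p. p \<in> Q \<Longrightarrow> \<bar>u p\<bar> \<le> B" "\<And>p. p \<in> Q \<Longrightarrow> \<bar>w p\<bar> \<le> B"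
    using Bu Bw by (force simp: B_def)+
  obtain d where d: "d > 0" "\<And>x y. \<bar>x - y\<bar> < d \<Longrightarrow> \<bar>u0 x - u0 y\<bar> < m / 16"
  proof -
    have "0 < m / 16" using m by simp
    then have "\<exists>d>0. \<forall>x y. dist x y < d \<longrightarrow> dist (u0 x) (u0 y) < m / 16"
      using u0(2) unfolding uniformly_continuous_on_def by blast
    then show thesis using that by (auto simp: dist_real_def)
  qed
  have u0': "bounded (range (\<lambda>x. - u0 x))" "uniformly_continuous_on UNIV (\<lambda>x. - u0 x)"
    using u0 by (auto simp: bounded_iff intro: uniformly_continuous_on_minus)
  obtain Ku where Ku: "Ku \<ge> 0" "\<And>t x. t > 0 \<Longrightarrow> u (t, x) \<le> u0 x + m / 32 + Ku * t"
    using subsolution_initial_bound[OF u \<rho> u0 init_u, of "m / 32"] m by auto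
  obtain Kw where Kw: "Kw \<ge> 0" "\<And>t x. t > 0 \<Longrightarrow> w (t, x) \<le> - u0 x + m / 32 + Kw * t"
    using subsolution_initial_bound[OF w \<rho> u0' init_w, of "m / 32"] m by auto
  \<comment> \<open>With this \<open>l\<close> the doubled functional at
    \<open>(t0, x0, t0, x0)\<close> equals \<open>m - 2 * l * t0 = m / 2\<close>.\<close>
  define l where "l = m / (4 * t0)"
  \<comment> \<open>Chosen so that \<open>(Ku + Kw + 1) * (3 * \<tau>) = m / 16\<close>: if one time
    is below \<tau> and the other within \<tau> of it, the growth since time 0 is at most
    \<open>m / 16\<close>.\<close>
  define \<tau> where "\<tau> = m / (48 * (Ku + Kw + 1))"
  \<comment> \<open>The three summands force \<open>|x - y| < 1\<close>, \<open>|x - y| < d\<close>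
    and \<open>|t - s| \<le> \<tau>\<close> on the superlevel set of \<open>m / 4\<close>.\<close>
  define N where "N = (2 * B + 1) * (1 + 1 / d ^ 4 + 1 / \<tau>\<^sup>2)"
  define T where "T = 2 * B / l"
  have l: "l > 0" using m t0 by (simp add: l_def)
  have \<tau>: "\<tau> > 0" using m Ku(1) Kw(1) by (simp add: \<tau>_def)
  have N_ge: "2 * B + 1 \<le> N" "(2 * B + 1) / d ^ 4 \<le> N" "(2 * B + 1) / \<tau>\<^sup>2 \<le> N"
  proof -
    have "0 \<le> (2 * B + 1) * (1 / d ^ 4)" "0 \<le> (2 * B + 1) * (1 / \<tau>\<^sup>2)"
      using B(1) d(1) \<tau> by (intro mult_nonneg_nonneg; simp)+
    moreover have "N = (2 * B + 1) + (2 * B + 1) * (1 / d ^ 4) + (2 * B + 1) * (1 / \<tau>\<^sup>2)"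
      by (simp add: N_def algebra_simps)
    ultimately show "2 * B + 1 \<le> N" "(2 * B + 1) / d ^ 4 \<le> N" "(2 * B + 1) / \<tau>\<^sup>2 \<le> N"
      using B(1) by simp_all
  qed
  have N: "N > 0" using N_ge(1) B(1) by linarith
  let ?\<Psi> = "dbl N l u w"
  have loc: "\<bar>x - y\<bar> \<le> 1 \<and> \<bar>t - s\<bar> \<le> \<tau> \<and> \<tau> \<le> t \<and> t \<le> T \<and> \<tau> \<le> s \<and> s \<le> T"
    if ts: "0 < t" "0 < s" and ge: "m / 4 \<le> ?\<Psi> t x s y" for t x s y
  proof -
    have uw: "u (t, x) \<le> B" "w (s, y) \<le> B"
      using B(2)[of "(t, x)"] B(3)[of "(s, y)"] ts by (auto simp: Q_def abs_le_iff)
    have nonneg: "0 \<le> N * (x - y) ^ 4" "0 \<le> N * (t - s)\<^sup>2" "0 \<le> l * t" "0 \<le> l * s"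
      using N l ts by auto
    have sum: "N * (x - y) ^ 4 + N * (t - s)\<^sup>2 + l * t + l * s < 2 * B + 1"
      using ge uw m by (simp add: dbl_def algebra_simps)
    have small: "\<bar>x - y\<bar> < c" if c: "c > 0" "(2 * B + 1) / c ^ 4 \<le> N" for c
    proof (rule ccontr)
      assume "\<not> \<bar>x - y\<bar> < c"
      then have "c ^ 4 \<le> \<bar>x - y\<bar> ^ 4" using c by (intro power_mono) auto
      then have "(2 * B + 1) / c ^ 4 * c ^ 4 \<le> N * (x - y) ^ 4"
        using c N B(1) by (intro mult_mono) auto
      then show False using sum nonneg c(1) by simp
    qed
    have xy: "\<bar>x - y\<bar> < 1" "\<bar>x - y\<bar> < d"
      using small[of 1] small[of d] N_ge d(1) by auto
    have ts_near: "\<bar>t - s\<bar> \<le> \<tau>"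
    proof (rule ccontr)
      assume "\<not> \<bar>t - s\<bar> \<le> \<tau>"
      then have "\<tau>\<^sup>2 \<le> \<bar>t - s\<bar>\<^sup>2" using \<tau> by (intro power_mono) auto
      then have "(2 * B + 1) / \<tau>\<^sup>2 * \<tau>\<^sup>2 \<le> N * (t - s)\<^sup>2"
        using \<tau> N B(1) N_ge by (intro mult_mono) auto
      then show False using sum nonneg \<tau> by simp
    qed
    have tT: "t \<le> T" "s \<le> T"
      using ge uw nonneg m l by (auto simp: T_def pos_le_divide_eq dbl_def algebra_simps)
    have "\<not> (t < \<tau> \<or> s < \<tau>)"
    proof
      assume "t < \<tau> \<or> s < \<tau>"
      then have "t + s \<le> 3 * \<tau>" using ts_near by linarith
      then have "(Ku + Kw + 1) * (t + s) \<le> (Ku + Kw + 1) * (3 * \<tau>)"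
        using Ku(1) Kw(1) by (intro mult_left_mono) auto
      also have "\<dots> = m / 16" using Ku(1) Kw(1) by (simp add: \<tau>_def field_simps)
      finally have 1: "(Ku + Kw + 1) * (t + s) \<le> m / 16" .
      have "Ku * t + Kw * s \<le> (Ku + Kw + 1) * (t + s)"
        using Ku(1) Kw(1) ts by (simp add: algebra_simps)
      \<comment> \<open>Three errors of \<open>m / 16\<close> each: the two slacks
        \<open>m / 32\<close>, the growth in time, and the oscillation of \<open>u0\<close> over
        distances below \<open>d\<close>. Their sum stays below \<open>m / 4\<close>.\<close>
      then have "u (t, x) + w (s, y) \<le> u0 x - u0 y + m / 16 + m / 16"
        using Ku(2)[OF ts(1), of x] Kw(2)[OF ts(2), of y] 1 by linarith
      also have "\<dots> < m / 4" using d(2)[OF xy(2)] m by linarith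
      finally have "u (t, x) + w (s, y) < m / 4" .
      then show False using ge nonneg by (simp add: dbl_def algebra_simps)
    qed
    then show ?thesis using xy ts_near tT by auto
  qed
  define X where "X = {?\<Psi> t x s y | t x s y. 0 < t \<and> 0 < s}"
  define S where "S = Sup X"
  have bdd: "bdd_above X"
  proof (rule bdd_aboveI[of _ "2 * B"])
    fix v assume "v \<in> X"
    then obtain t x s y where v: "v = ?\<Psi> t x s y" "0 < t" "0 < s" by (auto simp: X_def)
    have "u (t, x) \<le> B" "w (s, y) \<le> B"
      using B(2)[of "(t, x)"] B(3)[of "(s, y)"] v by (auto simp: Q_def abs_le_iff)
    moreover have "0 \<le> N * (x - y) ^ 4" "0 \<le> N * (t - s)\<^sup>2" "0 \<le> l * (t + s)"
      using N l v by auto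
    ultimately show "v \<le> 2 * B" by (simp add: v(1) dbl_def)
  qed
  have le_S: "?\<Psi> t x s y \<le> S" if "0 < t" "0 < s" for t x s y
    unfolding S_def using that by (intro cSup_upper bdd) (auto simp: X_def)
  have near_S: "\<exists>t x s y. 0 < t \<and> 0 < s \<and> S - \<kappa> < ?\<Psi> t x s y" if "\<kappa> > 0" for \<kappa>
  proof -
    have "?\<Psi> t0 x0 t0 x0 \<in> X" using t0 unfolding X_def by blast
    then have "X \<noteq> {}" by blast
    moreover have "S - \<kappa> < Sup X" using that by (simp add: S_def)
    ultimately obtain v where "v \<in> X" "S - \<kappa> < v" using less_cSupD by blast
    then show ?thesis by (auto simp: X_def)
  qed
  have "?\<Psi> t0 x0 t0 x0 = m / 2" using t0 by (simp add: dbl_def m_def l_def field_simps)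
  then have S_ge: "m / 2 \<le> S" using le_S[OF t0 t0, of x0 x0] by simp
  obtain K1 where K1: "K1 \<ge> 0"
    "\<And>w l \<eta> \<tau> T t1 x1 s1 y1. 0 < \<eta> \<Longrightarrow> \<eta> \<le> 1 \<Longrightarrow> 0 < \<tau> \<Longrightarrow> 0 < t1 \<Longrightarrow> \<bar>x1 - y1\<bar> \<le> \<eta> \<Longrightarrow>
      (\<And>t x. 0 < t \<Longrightarrow> dbl N l u w t x s1 y1 \<le> dbl N l u w t1 x1 s1 y1 + \<eta> ^ 4) \<Longrightarrow>
      (\<And>t x. 0 < t \<Longrightarrow> dbl N l u w t1 x1 s1 y1 - \<eta> ^ 4 \<le> dbl N l u w t x s1 y1 \<Longrightarrow>
        \<tau> \<le> t \<and> t \<le> T \<and> \<bar>x - y1\<bar> \<le> 1) \<Longrightarrow>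
      2 * N * (t1 - s1) + l \<le> K1 * \<eta>"
    by (fact dbl_frozen[OF u \<rho> N])
  obtain K2 where K2: "K2 \<ge> 0"
    "\<And>u l \<eta> \<tau> T t1 x1 s1 y1. 0 < \<eta> \<Longrightarrow> \<eta> \<le> 1 \<Longrightarrow> 0 < \<tau> \<Longrightarrow> 0 < t1 \<Longrightarrow> \<bar>x1 - y1\<bar> \<le> \<eta> \<Longrightarrow>
      (\<And>t x. 0 < t \<Longrightarrow> dbl N l w u t x s1 y1 \<le> dbl N l w u t1 x1 s1 y1 + \<eta> ^ 4) \<Longrightarrow>
      (\<And>t x. 0 < t \<Longrightarrow> dbl N l w u t1 x1 s1 y1 - \<eta> ^ 4 \<le> dbl N l w u t x s1 y1 \<Longrightarrow>
        \<tau> \<le> t \<and> t \<le> T \<and> \<bar>x - y1\<bar> \<le> 1) \<Longrightarrow>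
      2 * N * (t1 - s1) + l \<le> K2 * \<eta>"
    by (fact dbl_frozen[OF w \<rho> N])
  \<comment> \<open>\<open>m / 8\<close> keeps values down to \<open>S - 2 * \<eta> ^ 4\<close>
    above \<open>m / 4\<close>, where \<open>loc\<close> applies. The last entry makes the errors of
    the two frozen problems add up to at most \<open>l\<close>, against the required
    \<open>2 * l\<close>.\<close>
  define \<eta> where "\<eta> = min 1 (min (m / 8) (l / (K1 + K2 + 1)))"
  have \<eta>: "0 < \<eta>" "\<eta> \<le> 1" "\<eta> \<le> m / 8" "\<eta> \<le> l / (K1 + K2 + 1)"
  proof -
    have "0 < m / 8" "0 < l / (K1 + K2 + 1)" using m l K1(1) K2(1) by simp_all
    then show "0 < \<eta>" "\<eta> \<le> 1" "\<eta> \<le> m / 8" "\<eta> \<le> l / (K1 + K2 + 1)"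
      unfolding \<eta>_def by linarith+
  qed
  have \<eta>4: "0 < \<eta> ^ 4" "\<eta> ^ 4 \<le> m / 8"
    using \<eta> power_decreasing[of 1 4 \<eta>] by auto
  have separated: "\<eta> \<le> \<bar>x1 - y1\<bar>"
    if ts: "0 < t1" "0 < s1" and near: "S - \<eta> ^ 4 \<le> ?\<Psi> t1 x1 s1 y1" for t1 x1 s1 y1
  proof (rule ccontr)
    assume "\<not> ?thesis"
    then have xy: "\<bar>x1 - y1\<bar> \<le> \<eta>" "\<bar>y1 - x1\<bar> \<le> \<eta>" by auto
    have "2 * N * (t1 - s1) + l \<le> K1 * \<eta>"
    proof (rule K1(2)[OF \<eta>(1,2) \<tau> ts(1) xy(1)])
      show "?\<Psi> t x s1 y1 \<le> ?\<Psi> t1 x1 s1 y1 + \<eta> ^ 4" if "0 < t" for t x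
        using le_S[OF that ts(2), of x y1] near by linarith
      show "\<tau> \<le> t \<and> t \<le> T \<and> \<bar>x - y1\<bar> \<le> 1"
        if "0 < t" "?\<Psi> t1 x1 s1 y1 - \<eta> ^ 4 \<le> ?\<Psi> t x s1 y1" for t x
        using loc[OF that(1) ts(2), of x y1] that(2) near \<eta>4 S_ge by linarith
    qed
    moreover have "2 * N * (s1 - t1) + l \<le> K2 * \<eta>"
    proof (rule K2(2)[OF \<eta>(1,2) \<tau> ts(2) xy(2)])
      show "dbl N l w u s y t1 x1 \<le> dbl N l w u s1 y1 t1 x1 + \<eta> ^ 4" if "0 < s" for s y
        using le_S[OF ts(1) that, of x1 y] near unfolding dbl_swap[of N l w u] by linarith
      show "\<tau> \<le> s \<and> s \<le> T \<and> \<bar>y - x1\<bar> \<le> 1"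
        if "0 < s" "dbl N l w u s1 y1 t1 x1 - \<eta> ^ 4 \<le> dbl N l w u s y t1 x1" for s y
        using loc[OF ts(1) that(1), of x1 y] that(2) near \<eta>4 S_ge unfolding dbl_swap[of N l w u]
        by linarith
    qed
    \<comment> \<open>The time derivatives of the quadratic penalty are opposite and cancel in the
      sum.\<close>
    ultimately have "2 * l \<le> (K1 + K2) * \<eta>" by (simp add: algebra_simps)
    also have "\<dots> \<le> (K1 + K2 + 1) * \<eta>" using \<eta> by (intro mult_right_mono) auto
    also have "\<dots> \<le> l" using \<eta>(4) K1(1) K2(1) by (simp add: field_simps)
    finally show False using l by simp
  qed
  define C where "C = N * (6 + 4 * \<rho> + \<rho>\<^sup>2)"
  have C: "C \<ge> 0" using N \<rho> by (simp add: C_def)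
  define r where "r = min (\<rho> / 2) (l / (16 * N * (2 * C + 12)))"
  have r: "0 < r" "r < \<rho>" using \<rho> l N C by (auto simp: r_def)
  have r_le: "4 * N * (2 * r * (2 * C + 12)) \<le> l / 2"
  proof -
    have "r \<le> l / (16 * N * (2 * C + 12))" by (simp add: r_def)
    moreover have "0 < 16 * N * (2 * C + 12)" using N C by simp
    ultimately have "r * (16 * N * (2 * C + 12)) \<le> l" by (simp only: pos_le_divide_eq)
    then show ?thesis by (simp add: algebra_simps)
  qed
  define J where "J = (LINT z:(- {-r<..<r})|lborel. 1 / z\<^sup>2)"
  have J: "J \<ge> 0" unfolding J_def set_lebesgue_integral_def by (intro integral_nonneg_AE) auto
  define R where "R = 2 * r * (C + 12) + 2 * B * J + \<tau> / \<eta> ^ 3"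
  have R: "R \<ge> 0" using r C B(1) J \<tau> \<eta> by (simp add: R_def)
  \<comment> \<open>\<open>m / 4\<close> and \<open>\<eta> ^ 4\<close> make \<open>loc\<close> and
    \<open>separated\<close> available at the level \<open>S - \<delta>\<close>, and
    \<open>N * \<eta> ^ 3\<close> keeps the perturbed gradient nonzero. The last entry bounds the
    \<delta>-terms by \<open>l / 2\<close>; with \<open>r_le\<close> this gives
    \<open>2 * l \<le> l\<close>.\<close>
  define \<delta> where "\<delta> = Min {1, m / 4, \<eta> ^ 4, N * \<eta> ^ 3, l / (16 * N * J + 4 * R + 1)}"
  have den: "0 < 16 * N * J + 4 * R + 1" using N J R by (simp add: add_nonneg_pos)
  have \<delta>: "0 < \<delta>" "\<delta> \<le> 1" "\<delta> \<le> m / 4" "\<delta> \<le> \<eta> ^ 4" "\<delta> \<le> N * \<eta> ^ 3"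
    "\<delta> \<le> l / (16 * N * J + 4 * R + 1)"
    unfolding \<delta>_def using m \<eta>(1) N l den
    by (simp, (intro Min_le; simp)+)
  obtain t1 x1 s1 y1 where q1: "0 < t1" "0 < s1" "S - \<delta> < ?\<Psi> t1 x1 s1 y1"
    using near_S[OF \<delta>(1)] by blast
  define F where "F = (\<lambda>(p, q). ?\<Psi> (fst p) (snd p) (fst q) (snd q) + 2 * \<delta> * bump (snd p - x1))"
  \<comment> \<open>The range of \<open>y\<close> is wider by 1 because only \<open>x\<close> is
    localized and \<open>|x - y| \<le> 1\<close>.\<close>
  define L where "L = ({\<tau>..T} \<times> {x1 - 1..x1 + 1}) \<times> ({\<tau>..T} \<times> {x1 - 2..x1 + 2})"
  have "usc_on (Q \<times> Q) F"
  proof -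
    have bump: "continuous_on UNIV bump" using C2_realE[OF C2_real_bump] by blast
    have 1: "usc_on (Q \<times> Q) (\<lambda>z. u (fst z))"
      by (rule usc_on_compose[of Q u _ fst]) (use u in \<open>auto simp: subsolution_def intro!: continuous_intros\<close>)
    have 2: "usc_on (Q \<times> Q) (\<lambda>z. w (snd z))"
      by (rule usc_on_compose[of Q w _ snd]) (use w in \<open>auto simp: subsolution_def intro!: continuous_intros\<close>)
    have 3: "usc_on (Q \<times> Q) (\<lambda>z. - N * (snd (fst z) - snd (snd z)) ^ 4 - N * (fst (fst z) - fst (snd z))\<^sup>2
         - l * (fst (fst z) + fst (snd z)) + 2 * \<delta> * bump (snd (fst z) - x1))"
      by (intro continuous_on_imp_usc_on continuous_intros continuous_on_compose2[OF bump] subset_UNIV)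
    note usc_on_add[OF 1 usc_on_add[OF 2 3]]
    moreover have "(\<lambda>z. u (fst z) + (w (snd z)
      + (- N * (snd (fst z) - snd (snd z)) ^ 4 - N * (fst (fst z) - fst (snd z))\<^sup>2
         - l * (fst (fst z) + fst (snd z)) + 2 * \<delta> * bump (snd (fst z) - x1)))) = F"
      by (auto simp: F_def dbl_def fun_eq_iff)
    ultimately show ?thesis by simp
  qed
  moreover have "compact L" "L \<subseteq> Q \<times> Q" "((t1, x1), (s1, y1)) \<in> Q \<times> Q"
    using \<tau> q1 by (auto simp: L_def Q_def intro!: compact_Times)
  \<comment> \<open>At the near-maximizer the bump adds \<open>2 * \<delta>\<close>, so
    \<open>F\<close> exceeds \<open>S + \<delta>\<close> there. A point that does as well has bump
    value at least 1/2, since the doubled functional is at most \<open>S\<close>, and loses at most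
    \<delta> against \<open>S\<close>, since the bump is at most 1.\<close>
  moreover have level: "S - \<delta> \<le> ?\<Psi> t x s y \<and> \<bar>x - x1\<bar> \<le> 1"
    if ts: "0 < t" "0 < s" and ge: "F ((t1, x1), (s1, y1)) \<le> F ((t, x), (s, y))" for t x s y
  proof -
    have b0: "bump 0 = 1" by (simp add: bump_def)
    have *: "S + \<delta> \<le> ?\<Psi> t x s y + 2 * \<delta> * bump (x - x1)"
      using ge q1(3) by (simp add: F_def b0)
    have "2 * \<delta> * bump (x - x1) \<le> 2 * \<delta> * 1"
      using bump_bounds(2) \<delta>(1) by (intro mult_left_mono) auto
    then have 1: "S - \<delta> \<le> ?\<Psi> t x s y" using * by linarith
    have "\<delta> * 1 \<le> \<delta> * (2 * bump (x - x1))" using * le_S[OF ts, of x y] by simp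
    then have "1 \<le> 2 * bump (x - x1)" using \<delta>(1) by (subst (asm) mult_le_cancel_left_pos)
    then have "1 + (x - x1)\<^sup>2 \<le> 2"
      using bump_den[of "x - x1"] by (simp add: bump_def field_simps)
    then have "\<bar>x - x1\<bar> \<le> 1" by (simp add: abs_square_le_1)
    with 1 show ?thesis by simp
  qed
  moreover have "p \<in> L" if "p \<in> Q \<times> Q" "F ((t1, x1), (s1, y1)) \<le> F p" for p
  proof -
    obtain t x s y where p: "p = ((t, x), (s, y))" by (metis surj_pair)
    have ts: "0 < t" "0 < s" using that(1) p by (auto simp: Q_def)
    have *: "S - \<delta> \<le> ?\<Psi> t x s y" "\<bar>x - x1\<bar> \<le> 1" using level[OF ts] that(2) p by auto
    then have "\<bar>x - y\<bar> \<le> 1 \<and> \<bar>t - s\<bar> \<le> \<tau> \<and> \<tau> \<le> t \<and> t \<le> T \<and> \<tau> \<le> s \<and> s \<le> T"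
      using \<delta>(3) S_ge by (intro loc[OF ts]) linarith
    with *(2) show ?thesis by (auto simp: p L_def)
  qed
  ultimately obtain p where p: "p \<in> L" "F ((t1, x1), (s1, y1)) \<le> F p" "\<forall>q\<in>Q \<times> Q. F q \<le> F p"
    using usc_on_attains_sup_superlevel[of L "Q \<times> Q" F "((t1, x1), (s1, y1))"] by blast
  obtain t x s y where tx: "p = ((t, x), (s, y))" by (metis surj_pair)
  have ts: "0 < t" "0 < s" using p(1) \<tau> by (auto simp: tx L_def)
  have near: "S - \<delta> \<le> ?\<Psi> t x s y" using level[OF ts, of x y] p(2) tx by simp
  have loc': "\<bar>x - y\<bar> \<le> 1" "\<bar>t - s\<bar> \<le> \<tau>"
    using loc[OF ts, of x y] near \<delta>(3) S_ge by linarith+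
  have sep: "\<eta> \<le> \<bar>x - y\<bar>" using near \<delta>(4) by (intro separated[OF ts]) linarith
  have "2 * l \<le> 4 * N * (2 * r * (2 * C + 12) + 2 * \<delta> * J) + 2 * \<delta> * R"
    unfolding C_def J_def R_def
  proof (rule dbl_maximum_inequality[OF u w r B N less_imp_le[OF l] less_imp_le[OF \<delta>(1)] \<delta>(2) \<delta>(5) \<eta>(1)
        sep loc'(1) ts loc'(2)])
    show "?\<Psi> t' x' s' y' + 2 * \<delta> * bump (x' - x1) \<le> ?\<Psi> t x s y + 2 * \<delta> * bump (x - x1)"
      if "0 < t'" "0 < s'" for t' x' s' y'
      using bspec[OF p(3), of "((t', x'), (s', y'))"] that by (simp add: F_def tx Q_def)
  qed
  also have "\<dots> = 4 * N * (2 * r * (2 * C + 12)) + \<delta> * (16 * N * J + 4 * R) / 2"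
    by (simp add: algebra_simps)
  also have "\<delta> * (16 * N * J + 4 * R) \<le> \<delta> * (16 * N * J + 4 * R + 1)"
    using \<delta>(1) by (intro mult_left_mono) auto
  also have "\<dots> \<le> l" using \<delta>(6) den by (simp add: pos_le_divide_eq)
  finally show False using r_le l by linarith
qed

theorem theorem3p11:
  fixes u0 :: "real \<Rightarrow> real" and u v :: "real \<times> real \<Rightarrow> real" and \<rho> :: real
  assumes "\<rho> > 0"
    and "bounded (range u0)" and "uniformly_continuous_on UNIV u0"
    and "subsolution \<rho> u" and "supersolution \<rho> v"
    and "\<And>x. initial_upper u x \<le> ereal (u0 x)"
    and "\<And>x. ereal (u0 x) \<le> initial_lower v x"
  shows "\<forall>p\<in>Q. u p \<le> v p"
proof
  fix p assume "p \<in> Q"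
  then obtain t x where p: "p = (t, x)" "t > 0" by (auto simp: Q_def)
  have "u (t, x) + - v (t, x) \<le> 0"
  proof (rule subsolution_pair_nonpos[OF assms(1,4) subsolution_uminus[OF assms(5)] assms(2,3)])
    show "\<forall>\<^sub>F p in at (0, y) within Q. u p < a" if "u0 y < a" for y a
    proof -
      have "Limsup (at (0, y) within Q) (\<lambda>p. ereal (u p)) < ereal a"
        using assms(6)[of y] that unfolding initial_upper_def by (metis ereal_less(2) le_less_trans less_ereal.simps(1))
      from Limsup_lessD[OF this] show ?thesis by simp
    qed
    show "\<forall>\<^sub>F p in at (0, y) within Q. - v p < a" if "- u0 y < a" for y a
    proof -
      have "ereal (- a) < ereal (u0 y)" using that by simp
      also have "\<dots> \<le> Liminf (at (0, y) within Q) (\<lambda>p. ereal (v p))"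
        using assms(7)[of y] unfolding initial_lower_def .
      finally have "\<forall>\<^sub>F p in at (0, y) within Q. ereal (- a) < ereal (v p)"
        by (rule less_LiminfD)
      then show ?thesis by eventually_elim simp
    qed
  qed (rule p(2))
  then show "u p \<le> v p" using p(1) by simp
qed

end
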